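(* Let $p \geq 5$ be a prime and let $k$ be an integer with $3 \leq k \leq p$. Let $S$ be a finite $p$-group, and set $G = S/\mathfrak{X}_k(S)$. If $\operatorname{Baum}(G) = G$, then $J_e(S) \leq \mathfrak{X}_k(S)$. In particular, taking $k=p$, if $\operatorname{Baum}(S/\mathfrak{X}(S)) = S/\mathfrak{X}(S)$ then $J_e(S) \leq \mathfrak{X}(S)$ (that is, Oliver's conjecture holds for $S$).
   Context: For a finite $p$-group $H$, $\Omega_1(H)$ is the subgroup generated by the elements of order $p$ in $H$, and $\Omega_1Z(H) = \Omega_1(Z(H))$. The Thompson subgroup $J_e(H)$ is the subgroup of $H$ generated by the elementary abelian subgroups of $H$ of maximum order. The Baumann subgroup of $H$ is $\operatorname{Baum}(H) = C_H(\Omega_1Z(J_e(H)))$. Commutators are left-normed: $[X,Y]$ is the subgroup generated by all commutators $[x,y]$ with $x \in X$, $y\in Y$; $[X,Y;1]=[X,Y]$ and $[X,Y;n]=[[X,Y;n-1],Y]$. For $p$ an odd prime, $3 \leq k \leq p$, and $S$ a finite $p$-group, the $k$-th Oliver subgroup $\mathfrak{X}_k(S)$ is the largest subgroup of $S$ for which there exists a series $1 = Q_0 < Q_1 < \cdots < Q_n = \mathfrak{X}_k(S)$ with each $Q_i$ normal in $S$ and $[\Omega_1(C_S(Q_{i-1})), Q_i;\, k-1] = 1$ for all $1 \leq i \leq n$. (A largest such subgroup exists and is characteristic in $S$.) The Oliver subgroup is $\mathfrak{X}(S) = \mathfrak{X}_p(S)$. Oliver's conjecture for $S$ is the assertion $J_e(S)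 \leq \mathfrak{X}(S)$. *)

theory Defs
  imports "HOL-Algebra.Algebra"
begin

text \<open>
  All subgroups are represented by their carrier sets inside an ambient group. The parameter
  \<open>p\<close> is the prime for which the groups at hand are \<open>p\<close>-groups.
\<close>

definition finite_p_group :: "nat \<Rightarrow> ('a, 'b) monoid_scheme \<Rightarrow> bool" where
  "finite_p_group p G \<longleftrightarrow> group G \<and> finite (carrier G) \<and> (\<exists>m. order G = p ^ m)"

definition centralizer :: "('a, 'b) monoid_scheme \<Rightarrow> 'a set \<Rightarrow> 'a set" where
  "centralizer G A = {g \<in> carrier G. \<forall>x\<in>A. g \<otimes>\<^bsub>G\<^esub> x = x \<otimes>\<^bsub>G\<^esub> g}"

definition center :: "('a, 'b) monoid_scheme \<Rightarrow> 'a set \<Rightarrow> 'a set" where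
  "center G H = {z \<in> H. \<forall>h\<in>H. z \<otimes>\<^bsub>G\<^esub> h = h \<otimes>\<^bsub>G\<^esub> z}"

definition Omega1 :: "nat \<Rightarrow> ('a, 'b) monoid_scheme \<Rightarrow> 'a set \<Rightarrow> 'a set" where
  "Omega1 p G H = generate G {x \<in> H. group.ord G x = p}"

text \<open>The trivial subgroup counts as elementary abelian.\<close>

definition elementary_abelian :: "nat \<Rightarrow> ('a, 'b) monoid_scheme \<Rightarrow> 'a set \<Rightarrow> bool" where
  "elementary_abelian p G E \<longleftrightarrow>
     subgroup E G \<and> comm_group (G\<lparr>carrier := E\<rparr>) \<and> (\<forall>x\<in>E. x [^]\<^bsub>G\<^esub> p = \<one>\<^bsub>G\<^esub>)"

definition max_elementary_abelian :: "nat \<Rightarrow> ('a, 'b) monoid_scheme \<Rightarrow> 'a set \<Rightarrow> bool" where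
  "max_elementary_abelian p G E \<longleftrightarrow>
     elementary_abelian p G E \<and> (\<forall>F. elementary_abelian p G F \<longrightarrow> card F \<le> card E)"

definition thompson_subgroup :: "nat \<Rightarrow> ('a, 'b) monoid_scheme \<Rightarrow> 'a set" where
  "thompson_subgroup p G = generate G (\<Union>{E. max_elementary_abelian p G E})"

definition Baum :: "nat \<Rightarrow> ('a, 'b) monoid_scheme \<Rightarrow> 'a set" where
  "Baum p G = centralizer G (Omega1 p G (center G (thompson_subgroup p G)))"

definition commutator_subgroup :: "('a, 'b) monoid_scheme \<Rightarrow> 'a set \<Rightarrow> 'a set \<Rightarrow> 'a set" where
  "commutator_subgroup G A B =
     generate G {inv\<^bsub>G\<^esub> x \<otimes>\<^bsub>G\<^esub> inv\<^bsub>G\<^esub> y \<otimes>\<^bsub>G\<^esub> x \<otimes>\<^bsub>G\<^esub> y | x y. x \<in> A \<and> y \<in> B}"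

text \<open>\<open>iter_commutator G A B n\<close> is \<open>[A, B; n]\<close>, extended to \<open>n = 0\<close> by \<open>[A, B; 0] = A\<close>.\<close>

primrec iter_commutator ::
    "('a, 'b) monoid_scheme \<Rightarrow> 'a set \<Rightarrow> 'a set \<Rightarrow> nat \<Rightarrow> 'a set" where
  "iter_commutator G A B 0 = A"
| "iter_commutator G A B (Suc n) = commutator_subgroup G (iter_commutator G A B n) B"

text \<open>The series may have length \<open>n = 0\<close>, so that the trivial subgroup always admits one.\<close>

definition has_oliver_series ::
    "nat \<Rightarrow> nat \<Rightarrow> ('a, 'b) monoid_scheme \<Rightarrow> 'a set \<Rightarrow> bool" where
  "has_oliver_series p k S K \<longleftrightarrow>
     (\<exists>(Q :: nat \<Rightarrow> 'a set) n.
        Q 0 = {\<one>\<^bsub>S\<^esub>} \<and> Q n = K \<and>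
        (\<forall>i<n. Q i \<subset> Q (Suc i)) \<and>
        (\<forall>i\<le>n. Q i \<lhd> S) \<and>
        (\<forall>i\<in>{1..n}.
           iter_commutator S (Omega1 p S (centralizer S (Q (i - 1)))) (Q i) (k - 1) = {\<one>\<^bsub>S\<^esub>}))"

text \<open>
  The \<open>k\<close>-th Oliver subgroup is the largest subgroup admitting such a series, with respect to
  inclusion. It exists for a finite \<open>p\<close>-group: if \<open>K\<close> and \<open>L\<close> admit series \<open>Q\<close> and \<open>R\<close>, then
  \<open>K L\<close> admits the series that continues \<open>Q\<close> with the terms \<open>K (R i)\<close>, repetitions omitted.
\<close>

definition oliver_subgroup :: "nat \<Rightarrow> nat \<Rightarrow> ('a, 'b) monoid_scheme \<Rightarrow> 'a set" where
  "oliver_subgroup p k S = (GREATEST K. has_oliver_series p k S K)"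

definition oliver_conjecture :: "nat \<Rightarrow> ('a, 'b) monoid_scheme \<Rightarrow> bool" where
  "oliver_conjecture p S \<longleftrightarrow> thompson_subgroup p S \<subseteq> oliver_subgroup p p S"

end

theory Submission
  imports Defs
begin

text \<open>
  Write \<open>X\<close> for the \<open>k\<close>-th Oliver subgroup of \<open>S\<close>, and put \<open>V = \<Omega>\<^sub>1(C\<^sub>S(X))\<close> and \<open>G = S/X\<close>. Call an
  element \<^emph>\<open>quadratic\<close> on an elementary abelian normal subgroup \<open>W\<close> if \<open>[[w,x],x] = 1\<close> for all
  \<open>w \<in> W\<close>. The proof confronts two opposite statements about quadratic elements.

  Maximality of \<open>X\<close> forbids them in the centre: an element \<open>x\<close> that is central modulo \<open>X\<close> and
  quadratic on \<open>V\<close> lies in \<open>X\<close>, because \<open>X\<langle>x\<rangle>\<close> would prolong the Oliver series of \<open>X\<close>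
  (\<open>oliver_subgroup_absorbs\<close>). The same fact, applied to elements of \<open>C\<^sub>S(X)\<close> and of \<open>C\<^sub>S(V)\<close>, shows
  that \<open>C\<^sub>S(X) \<le> X\<close>, so that \<open>V\<close> is elementary abelian, and that \<open>C\<^sub>S(V) = X\<close>.

  If \<open>J\<^sub>e(S)\<close> is not contained in \<open>X = C\<^sub>S(V)\<close>, then Thompson's replacement argument produces an
  element outside \<open>X\<close> that is quadratic on \<open>V\<close> (\<open>ex_quadratic_on_normal\<close>). It remains to move this
  element into the centre of \<open>G\<close>. The tool is a closure property (\<open>quadratic_commutator\<close>): if \<open>b\<close> is
  quadratic and \<open>[a,b]\<close> commutes with \<open>a\<close> and \<open>b\<close> (modulo the kernel of the action), then \<open>[a,b]\<close> is
  quadratic. The relevant properties of the set of quadratic elements of \<open>G\<close> are abstracted as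
  \<open>quadratic_family\<close>. In any \<open>p\<close>-group, a nontrivial such family \<open>Q\<close> has a nontrivial member that
  commutes with all its conjugates: push a member into a maximal normal abelian subgroup \<open>M\<close> by taking
  commutators with \<open>M\<close>, using \<open>C(M) = M\<close>
  (\<open>quadratic_family_ex_commuting_conjugates\<close>).

  Hence \<open>G\<close> has an elementary abelian normal subgroup meeting \<open>Q\<close> nontrivially; let \<open>W\<close> be a smallest
  one (\<open>ex_central_quadratic\<close>). If \<open>J\<^sub>e(G)\<close> centralizes \<open>W\<close>, then \<open>W \<le> \<Omega>\<^sub>1Z(J\<^sub>e(G))\<close>, which is central
  in \<open>G\<close> because \<open>Baum(G) = G\<close>, and \<open>Q\<close> has a nontrivial central member. Otherwise the replacement
  argument applies to \<open>W\<close> inside \<open>G\<close>, and the elements of \<open>G/C\<^sub>G(W)\<close> that are quadratic on \<open>W\<close> again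
  form such a family; it yields \<open>e \<notin> C\<^sub>G(W)\<close>, quadratic on \<open>W\<close>, whose conjugates commute modulo
  \<open>C\<^sub>G(W)\<close>. Replacing a member \<open>b \<in> W\<close> of \<open>Q\<close> by commutators with these conjugates, one at a time,
  leads to a nontrivial member of \<open>Q\<close> in the proper normal subgroup \<open>C\<^sub>W(e\<^sup>G)\<close> of \<open>W\<close>, against the
  choice of \<open>W\<close>.
\<close>

section \<open>Conjugation, commutators and centralizers\<close>

context group
begin

definition cj :: "'a \<Rightarrow> 'a \<Rightarrow> 'a" where
  "cj u x = inv x \<otimes> u \<otimes> x"

definition comm :: "'a \<Rightarrow> 'a \<Rightarrow> 'a" where
  "comm x y = inv x \<otimes> inv y \<otimes> x \<otimes> y"

lemma inv_cancel_left [simp]: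
  assumes "x \<in> carrier G" "y \<in> carrier G"
  shows "inv x \<otimes> (x \<otimes> y) = y" "x \<otimes> (inv x \<otimes> y) = y"
  using assms by (simp_all flip: m_assoc)

lemma cj_closed [simp, intro]: "u \<in> carrier G \<Longrightarrow> x \<in> carrier G \<Longrightarrow> cj u x \<in> carrier G"
  by (simp add: cj_def)

lemma comm_closed [simp, intro]: "x \<in> carrier G \<Longrightarrow> y \<in> carrier G \<Longrightarrow> comm x y \<in> carrier G"
  by (simp add: comm_def)

lemma cj_mult:
  assumes "u \<in> carrier G" "v \<in> carrier G" "x \<in> carrier G"
  shows "cj (u \<otimes> v) x = cj u x \<otimes> cj v x"
  using assms by (simp add: cj_def m_assoc)

lemma cj_cj:
  assumes "u \<in> carrier G" "x \<in> carrier G" "y \<in> carrier G"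
  shows "cj (cj u x) y = cj u (x \<otimes> y)"
  using assms by (simp add: cj_def m_assoc inv_mult_group)

lemma cj_one [simp]: "u \<in> carrier G \<Longrightarrow> cj u \<one> = u" "x \<in> carrier G \<Longrightarrow> cj \<one> x = \<one>"
  by (simp_all add: cj_def)

lemma cj_inv:
  assumes "u \<in> carrier G" "x \<in> carrier G"
  shows "cj (inv u) x = inv (cj u x)"
  using assms by (simp add: cj_def m_assoc inv_mult_group)

lemma cj_cj_inv [simp]:
  assumes "u \<in> carrier G" "x \<in> carrier G"
  shows "cj (cj u x) (inv x) = u" "cj (cj u (inv x)) x = u"
  using assms by (simp_all add: cj_cj)

lemma cj_inject:
  assumes "u \<in> carrier G" "v \<in> carrier G" "x \<in> carrier G"
  shows "cj u x = cj v x \<longleftrightarrow> u = v"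
  using assms by (metis cj_cj_inv(1))

lemma comm_eq_cj: "x \<in> carrier G \<Longrightarrow> y \<in> carrier G \<Longrightarrow> comm x y = inv x \<otimes> cj x y"
  by (simp add: comm_def cj_def m_assoc)

lemma cj_eq_comm: "x \<in> carrier G \<Longrightarrow> y \<in> carrier G \<Longrightarrow> cj x y = x \<otimes> comm x y"
  by (simp add: comm_eq_cj)

lemma cj_comm:
  assumes "x \<in> carrier G" "y \<in> carrier G" "g \<in> carrier G"
  shows "cj (comm x y) g = comm (cj x g) (cj y g)"
  using assms by (simp add: cj_def comm_def m_assoc inv_mult_group)

lemma comm_eq_one_iff:
  assumes "x \<in> carrier G" "y \<in> carrier G"
  shows "comm x y = \<one> \<longleftrightarrow> x \<otimes> y = y \<otimes> x"
proof -
  have "comm x y = inv (y \<otimes> x) \<otimes> (x \<otimes> y)"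
    using assms by (simp add: comm_def m_assoc inv_mult_group)
  then show ?thesis using assms
    by (metis inv_cancel_left(2) inv_closed l_inv m_closed r_one)
qed

lemma cj_eq_iff:
  assumes "u \<in> carrier G" "x \<in> carrier G"
  shows "cj u x = u \<longleftrightarrow> u \<otimes> x = x \<otimes> u"
  using assms by (metis cj_eq_comm comm_closed comm_eq_one_iff inv_cancel_left(1) l_inv r_one)

lemma normal_cj_closed: "H \<lhd> G \<Longrightarrow> u \<in> H \<Longrightarrow> x \<in> carrier G \<Longrightarrow> cj u x \<in> H"
  by (simp add: cj_def normal.inv_op_closed1)

lemma normal_comm_closed:
  assumes "H \<lhd> G" "u \<in> H" "x \<in> carrier G"
  shows "comm u x \<in> H"
proof -
  have "subgroup H G" using assms by (simp add: normal_imp_subgroup)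
  then show ?thesis
    using assms normal_cj_closed[OF assms] subgroup.mem_carrier
    by (metis comm_eq_cj subgroup.m_closed subgroup.m_inv_closed)
qed

lemma normalI_cj:
  assumes "subgroup H G" "\<And>u x. u \<in> H \<Longrightarrow> x \<in> carrier G \<Longrightarrow> cj u x \<in> H"
  shows "H \<lhd> G"
proof (rule normal_invI[OF assms(1)])
  fix x h assume "x \<in> carrier G" "h \<in> H"
  then show "x \<otimes> h \<otimes> inv x \<in> H"
    using assms(2)[of h "inv x"] by (simp add: cj_def)
qed

lemma subgroup_centralizer: "A \<subseteq> carrier G \<Longrightarrow> subgroup (centralizer G A) G"
proof (rule subgroupI)
  fix g assume A: "A \<subseteq> carrier G" and g: "g \<in> centralizer G A"
  show "inv g \<in> centralizer G A"
    unfolding centralizer_def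
  proof (clarsimp, intro conjI ballI)
    show "inv g \<in> carrier G" using g by (simp add: centralizer_def)
    fix x assume "x \<in> A"
    then have x: "x \<in> carrier G" "g \<in> carrier G" "g \<otimes> x = x \<otimes> g"
      using A g by (auto simp: centralizer_def)
    have "inv g \<otimes> x = inv g \<otimes> (x \<otimes> g) \<otimes> inv g"
      using x(1,2) by (simp add: m_assoc)
    also have "\<dots> = x \<otimes> inv g" unfolding x(3)[symmetric] using x(1,2) by simp
    finally show "inv g \<otimes> x = x \<otimes> inv g" .
  qed
next
  fix g h assume A: "A \<subseteq> carrier G" and gh: "g \<in> centralizer G A" "h \<in> centralizer G A"
  have "g \<otimes> h \<otimes> x = x \<otimes> (g \<otimes> h)" if "x \<in> A" for x
  proof -
    have c: "x \<in> carrier G" "g \<in> carrier G" "h \<in> carrier G"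
      "g \<otimes> x = x \<otimes> g" "h \<otimes> x = x \<otimes> h"
      using A gh that by (auto simp: centralizer_def)
    then have "g \<otimes> h \<otimes> x = g \<otimes> x \<otimes> h" using m_assoc by metis
    then show ?thesis using c m_assoc by metis
  qed
  then show "g \<otimes> h \<in> centralizer G A" using gh by (auto simp: centralizer_def)
next
  assume A: "A \<subseteq> carrier G"
  have "\<one> \<in> centralizer G A" using A by (auto simp: centralizer_def)
  then show "centralizer G A \<noteq> {}" by blast
qed (auto simp: centralizer_def)

text \<open>
  The relation "every element of one set commutes with every element of the other" is symmetric;
  this is the form in which the symmetry is used.
\<close>

lemma centralizer_swap: "A \<subseteq> carrier G \<Longrightarrow> B \<subseteq> centralizer G A \<Longrightarrow> A \<subseteq> centralizer G B"
  unfolding centralizer_def subset_iff mem_Collect_eq by metis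

lemma centralizerD: "x \<in> centralizer G A \<Longrightarrow> a \<in> A \<Longrightarrow> x \<otimes> a = a \<otimes> x"
  unfolding centralizer_def by blast

lemma centralizerI: "x \<in> carrier G \<Longrightarrow> (\<And>a. a \<in> A \<Longrightarrow> x \<otimes> a = a \<otimes> x) \<Longrightarrow> x \<in> centralizer G A"
  unfolding centralizer_def by blast

text \<open>
  Conjugates of generators need only lie in the generated subgroup, not among the generators. This
  covers generating sets such as \<open>insert x K\<close> below.
\<close>

lemma generate_conj_normal:
  assumes "A \<subseteq> carrier G" "\<And>a x. a \<in> A \<Longrightarrow> x \<in> carrier G \<Longrightarrow> cj a x \<in> generate G A"
  shows "generate G A \<lhd> G"
proof (rule normalI_cj)
  show sub: "subgroup (generate G A) G" using assms(1) by (rule generate_is_subgroup)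
  fix u x assume "u \<in> generate G A" and x: "x \<in> carrier G"
  then show "cj u x \<in> generate G A"
  proof (induction u rule: generate.induct)
    case one then show ?case by (simp add: generate.one)
  next
    case (incl h) then show ?case using assms(2) by blast
  next
    case (inv h) then show ?case
      using assms(1) assms(2)[of h x] cj_inv[of h x] subgroup.m_inv_closed[OF sub] by auto
  next
    case (eng h1 h2) then show ?case
      using cj_mult[of h1 h2 x] generate_in_carrier[OF assms(1)] by (simp add: generate.eng)
  qed
qed

lemma generate_commute:
  assumes "A \<subseteq> carrier G" "\<And>a b. a \<in> A \<Longrightarrow> b \<in> A \<Longrightarrow> a \<otimes> b = b \<otimes> a"
    and "x \<in> generate G A" "y \<in> generate G A"
  shows "x \<otimes> y = y \<otimes> x"
proof -
  have "generate G A \<subseteq> centralizer G A"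
    using assms(1,2) by (intro generate_subgroup_incl subgroup_centralizer) (simp_all add: centralizer_def subset_iff)
  then have "A \<subseteq> centralizer G (generate G A)"
    by (rule centralizer_swap[OF assms(1)])
  then have "generate G A \<subseteq> centralizer G (generate G A)"
    using assms(1) by (intro generate_subgroup_incl subgroup_centralizer generate_incl)
  then show ?thesis using assms(3,4) by (simp add: centralizer_def subset_iff)
qed

lemma centralizer_generate:
  assumes "A \<subseteq> carrier G"
  shows "centralizer G A \<subseteq> centralizer G (generate G A)"
proof -
  have "A \<subseteq> centralizer G (centralizer G A)"
    using assms by (rule centralizer_swap) simp
  moreover have CG: "centralizer G A \<subseteq> carrier G" by (simp add: centralizer_def subset_iff)
  ultimately have "generate G A \<subseteq> centralizer G (centralizer G A)"
    by (intro generate_subgroup_incl subgroup_centralizer)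
  then show ?thesis by (rule centralizer_swap[OF CG])
qed

lemma comm_mult_left:
  assumes "u \<in> carrier G" "v \<in> carrier G" "x \<in> carrier G"
    and "comm u x \<otimes> v = v \<otimes> comm u x"
  shows "comm (u \<otimes> v) x = comm u x \<otimes> comm v x"
proof -
  have "comm (u \<otimes> v) x = inv v \<otimes> (comm u x \<otimes> v) \<otimes> comm v x"
    using assms(1-3) by (simp add: comm_def m_assoc inv_mult_group)
  then show ?thesis using assms(1-3) unfolding assms(4) by simp
qed

lemma comm_inv_left:
  assumes "u \<in> carrier G" "x \<in> carrier G"
    and "comm u x \<otimes> u = u \<otimes> comm u x"
  shows "comm (inv u) x = inv (comm u x)"
proof -
  have "comm u x \<otimes> inv u = inv u \<otimes> (u \<otimes> comm u x) \<otimes> inv u"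
    using assms(1,2) by (simp add: m_assoc)
  also have "\<dots> = inv u \<otimes> comm u x" unfolding assms(3)[symmetric] using assms(1,2) by (simp add: m_assoc)
  finally have "inv (inv u \<otimes> comm u x) = inv (comm u x \<otimes> inv u)" by simp
  then have *: "inv (comm u x) \<otimes> u = u \<otimes> inv (comm u x)" using assms(1,2) by (simp add: inv_mult_group)
  have "comm (inv u) x = u \<otimes> inv (comm u x) \<otimes> inv u"
    using assms(1,2) by (simp add: comm_def m_assoc inv_mult_group)
  then show ?thesis using assms(1,2) by (simp flip: * add: m_assoc)
qed

lemma comm_mult_right:
  assumes "v \<in> carrier G" "q \<in> carrier G" "r \<in> carrier G"
  shows "comm v (q \<otimes> r) = comm v r \<otimes> cj (comm v q) r"
  using assms by (simp add: comm_def cj_def m_assoc inv_mult_group)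

lemma comm_inv_right:
  assumes "v \<in> carrier G" "q \<in> carrier G"
  shows "comm v (inv q) = inv (cj (comm v q) (inv q))"
  using assms by (simp add: comm_def cj_def m_assoc inv_mult_group)

lemma cj_centralizer:
  assumes "W \<subseteq> carrier G" "w \<in> W" "k \<in> centralizer G W"
  shows "cj w k = w"
  using assms centralizerD[OF assms(3,2)] cj_eq_iff[of w k] by (auto simp: centralizer_def)

lemma normal_centralizer:
  assumes "W \<lhd> G"
  shows "centralizer G W \<lhd> G"
proof -
  have W: "W \<subseteq> carrier G" using assms by (simp add: normal_imp_subgroup subgroup.subset)
  show ?thesis
  proof (rule normalI_cj[OF subgroup_centralizer[OF W]])
    fix k x assume k: "k \<in> centralizer G W" and x: "x \<in> carrier G"
    then have kG: "k \<in> carrier G" by (simp add: centralizer_def)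
    show "cj k x \<in> centralizer G W"
    proof (rule centralizerI)
      fix w assume w: "w \<in> W"
      then have wG: "w \<in> carrier G" using W by blast
      have "k \<otimes> cj w (inv x) = cj w (inv x) \<otimes> k"
        using normal_cj_closed[OF assms w] x centralizerD[OF k] by simp
      then have "cj (k \<otimes> cj w (inv x)) x = cj (cj w (inv x) \<otimes> k) x" by simp
      then show "cj k x \<otimes> w = w \<otimes> cj k x" using kG wG x by (simp add: cj_mult)
    qed (use kG x in simp)
  qed
qed

lemma normal_generate_insert:
  assumes K: "K \<lhd> G" and x: "x \<in> carrier G" and comm: "\<And>g. g \<in> carrier G \<Longrightarrow> comm x g \<in> K"
  shows "generate G (insert x K) \<lhd> G"
proof (rule generate_conj_normal)
  show "insert x K \<subseteq> carrier G" using K x by (simp add: normal_imp_subgroup subgroup.subset)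
  fix a g assume a: "a \<in> insert x K" and g: "g \<in> carrier G"
  show "cj a g \<in> generate G (insert x K)"
  proof (cases "a = x")
    case True
    have "x \<otimes> comm x g \<in> generate G (insert x K)"
      using comm[OF g] by (intro generate.eng generate.incl) auto
    then show ?thesis using True g x by (simp add: cj_eq_comm)
  next
    case False
    then show ?thesis using a g normal_cj_closed[OF K] by (intro generate.incl) simp
  qed
qed

lemma normal_set_mult:
  assumes "K \<lhd> G" "R \<lhd> G"
  shows "K <#> R \<lhd> G"
proof (rule normalI_cj)
  show "subgroup (K <#> R) G" using mult_norm_subgroup[OF assms(1) normal_imp_subgroup[OF assms(2)]] .
  fix u x assume "u \<in> K <#> R" and x: "x \<in> carrier G"
  then obtain y r where yr: "y \<in> K" "r \<in> R" "u = y \<otimes> r" unfolding set_mult_def by blast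
  moreover have "y \<in> carrier G" "r \<in> carrier G"
    using yr assms by (meson normal_imp_subgroup subgroup.mem_carrier)+
  ultimately have "cj u x = cj y x \<otimes> cj r x" using x by (simp add: cj_mult)
  then show "cj u x \<in> K <#> R"
    using normal_cj_closed[OF assms(1) yr(1) x] normal_cj_closed[OF assms(2) yr(2) x]
    by (auto simp: set_mult_def)
qed

lemma coset_eq_one_iff:
  assumes "K \<lhd> G" "x \<in> carrier G"
  shows "K #> x = \<one>\<^bsub>G Mod K\<^esub> \<longleftrightarrow> x \<in> K"
  using assms normal_imp_subgroup[OF assms(1)]
  by (metis coset_join1 coset_join2 subgroup.subset one_FactGroup)

lemma group_hom_quotient: "K \<lhd> G \<Longrightarrow> group_hom G (G Mod K) (\<lambda>x. K #> x)"
  by (simp add: group_hom_def group_hom_axioms_def normal.factorgroup_is_group normal.r_coset_hom_Mod)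

lemma cj_quotient:
  assumes "K \<lhd> G" "x \<in> carrier G" "y \<in> carrier G"
  shows "group.cj (G Mod K) (K #> x) (K #> y) = K #> cj x y"
proof -
  interpret h: group_hom G "G Mod K" "\<lambda>x. K #> x" using assms(1) by (rule group_hom_quotient)
  show ?thesis using assms(2,3) by (simp add: h.H.cj_def cj_def del: mult_FactGroup)
qed

lemma comm_quotient:
  assumes "K \<lhd> G" "x \<in> carrier G" "y \<in> carrier G"
  shows "group.comm (G Mod K) (K #> x) (K #> y) = K #> comm x y"
proof -
  interpret h: group_hom G "G Mod K" "\<lambda>x. K #> x" using assms(1) by (rule group_hom_quotient)
  show ?thesis using assms(2,3) by (simp add: h.H.comm_def comm_def del: mult_FactGroup)
qed

end

section \<open>Fixed points of finite p-groups\<close>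

text \<open>
  An orbit without fixed point has more than one element, and its length divides \<open>p\<^sup>m\<close>. Without
  fixed points \<open>p\<close> would divide every orbit length, hence the cardinality of the set.
\<close>

lemma (in group_action) p_group_fixed_point:
  assumes "Factorial_Ring.prime (p::nat)" "order G = p ^ m" "finite E" "\<not> p dvd card E"
  shows "\<exists>x\<in>E. \<forall>g\<in>carrier G. \<phi> g x = x"
proof (rule ccontr)
  assume none: "\<not> (\<exists>x\<in>E. \<forall>g\<in>carrier G. \<phi> g x = x)"
  interpret group G using group_hom group_hom.axioms(1) by blast
  have orb: "p dvd card Z" if "Z \<in> orbits G E \<phi>" for Z
  proof -
    obtain x where x: "x \<in> E" "Z = orbit G \<phi> x" using \<open>Z \<in> orbits G E \<phi>\<close> by (auto simp: orbits_def)
    obtain g where g: "g \<in> carrier G" "\<phi> g x \<noteq> x" using none x(1) by blast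
    have "{x, \<phi> g x} \<subseteq> Z" using orbit_refl[OF x(1)] g unfolding x(2) by (auto simp: orbit_def)
    moreover have "Z \<subseteq> E" using orbits_coverture \<open>Z \<in> orbits G E \<phi>\<close> by blast
    ultimately have "card Z \<noteq> 1"
      using g(2) by (metis card_1_singletonE insert_subset singletonD)
    moreover have "card Z dvd p ^ m"
      using orbit_stabilizer_theorem[OF x(1)] assms(2) unfolding x(2) by (metis dvd_triv_left)
    ultimately show ?thesis
      using assms(1) by (metis divides_primepow_nat dvd_power gr0I power_0)
  qed
  have "card E = (\<Sum>Z\<in>orbits G E \<phi>. card Z)"
    unfolding card_eq_sum by (rule disjoint_sum[OF assms(3), symmetric])
  then have "p dvd card E" using orb by (simp add: dvd_sum)
  then show False using assms(4) by simp
qed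

lemma (in group) group_actionI:
  assumes closed: "\<And>g x. g \<in> carrier G \<Longrightarrow> x \<in> E \<Longrightarrow> f g x \<in> E"
    and one: "\<And>x. x \<in> E \<Longrightarrow> f \<one> x = x"
    and mult: "\<And>g h x. g \<in> carrier G \<Longrightarrow> h \<in> carrier G \<Longrightarrow> x \<in> E \<Longrightarrow> f (g \<otimes> h) x = f g (f h x)"
  shows "group_action G E (\<lambda>g. \<lambda>x\<in>E. f g x)"
proof -
  have Bij: "(\<lambda>x\<in>E. f g x) \<in> Bij E" if g: "g \<in> carrier G" for g
  proof -
    have "bij_betw (f g) E E"
      by (rule bij_betwI[where g = "f (inv g)"])
        (use g in \<open>auto simp: closed one simp flip: mult\<close>)
    then show ?thesis by (simp add: Bij_def)
  qed
  have "(\<lambda>x\<in>E. f (g \<otimes> h) x) = compose E (\<lambda>x\<in>E. f g x) (\<lambda>x\<in>E. f h x)"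
    if "g \<in> carrier G" "h \<in> carrier G" for g h
    using that by (auto simp: compose_def mult closed)
  then have "(\<lambda>g. \<lambda>x\<in>E. f g x) \<in> hom G (BijGroup E)"
    using Bij by (auto simp: hom_def BijGroup_def)
  then show ?thesis
    by (simp add: group_action_def group_hom_def group_hom_axioms_def group_BijGroup is_group)
qed

locale p_group = group G for G (structure) +
  fixes p :: nat
  assumes prime_p: "Factorial_Ring.prime p" and finite_p_group: "finite_p_group p G"
begin

lemma finite_carrier [simp]: "finite (carrier G)"
  using finite_p_group by (simp add: finite_p_group_def)

lemma finite_subset_carrier: "A \<subseteq> carrier G \<Longrightarrow> finite A"
  using finite_carrier finite_subset by blast

lemma subgroup_card_eq_power:
  assumes "subgroup H G"
  obtains j where "card H = p ^ j"
proof -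
  obtain m where "order G = p ^ m" using finite_p_group by (auto simp: finite_p_group_def)
  then have "card H dvd p ^ m" using lagrange[OF assms] by (metis dvd_triv_right)
  then show ?thesis using that prime_p by (auto simp: divides_primepow_nat)
qed

lemma p_group_subgroup:
  assumes "subgroup H G"
  shows "p_group (G\<lparr>carrier := H\<rparr>) p"
proof -
  interpret H: group "G\<lparr>carrier := H\<rparr>" using assms by (rule subgroup_imp_group)
  obtain j where "card H = p ^ j" using subgroup_card_eq_power[OF assms] .
  then show ?thesis
    using assms finite_subset_carrier[OF subgroup.subset[OF assms]] prime_p H.is_group
    by (unfold_locales) (auto simp: finite_p_group_def order_def)
qed

text \<open>
  The single consequence of nilpotency that the proof needs. The \<open>p\<close>-group \<open>E\<close> acts by conjugation
  on the cosets of \<open>A\<close> in \<open>B\<close>. Their number is a power of \<open>p\<close> other than 1, and the coset \<open>A\<close> itself is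
  fixed, so some other coset is fixed as well. With \<open>E\<close> the whole group and \<open>A\<close>, \<open>B\<close> normal, this gives
  elements of \<open>B - A\<close> that are central modulo \<open>A\<close>.
\<close>

lemma ex_fixed_coset:
  assumes A: "subgroup A G" and B: "subgroup B G" and E: "subgroup E G" and "A \<subset> B"
    and cjA: "\<And>a e. a \<in> A \<Longrightarrow> e \<in> E \<Longrightarrow> cj a e \<in> A"
    and cjB: "\<And>b e. b \<in> B \<Longrightarrow> e \<in> E \<Longrightarrow> cj b e \<in> B"
  shows "\<exists>x\<in>B - A. \<forall>e\<in>E. comm x e \<in> A"
proof -
  interpret A: subgroup A G by fact
  interpret B: subgroup B G by fact
  interpret E: subgroup E G by fact
  interpret GE: p_group "G\<lparr>carrier := E\<rparr>" p using E by (rule p_group_subgroup)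
  interpret GB: p_group "G\<lparr>carrier := B\<rparr>" p using B by (rule p_group_subgroup)
  have AB: "subgroup A (G\<lparr>carrier := B\<rparr>)" using \<open>A \<subset> B\<close> by (simp add: A B subgroup_incl)
  \<comment> \<open>The cosets of \<open>A\<close> in \<open>B\<close> other than \<open>A\<close>. The inverse in \<open>f\<close> turns conjugation into a left action.\<close>
  define Y where "Y = {A #> x | x. x \<in> B - A}"
  define f where "f e Z = (\<lambda>x. cj x (inv e)) ` Z" for e Z
  have f_coset: "f e (A #> x) = A #> cj x (inv e)" if "e \<in> E" "x \<in> carrier G" for e x
  proof
    have e: "e \<in> carrier G" "inv e \<in> E" using that by auto
    show "f e (A #> x) \<subseteq> A #> cj x (inv e)"
      using that e cjA by (fastforce simp: f_def r_coset_def cj_mult)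
    show "A #> cj x (inv e) \<subseteq> f e (A #> x)"
    proof
      fix y assume "y \<in> A #> cj x (inv e)"
      then obtain a where a: "a \<in> A" "y = a \<otimes> cj x (inv e)" by (auto simp: r_coset_def)
      then have "y = cj (cj a e \<otimes> x) (inv e)" using that e by (simp add: cj_mult)
      then show "y \<in> f e (A #> x)"
        using a cjA[OF a(1) that(1)] by (auto simp: f_def r_coset_def)
    qed
  qed
  have finB: "finite B" using finite_subset_carrier B.subset by blast
  have finY: "finite Y" unfolding Y_def using finB by simp
  have "rcosets\<^bsub>G\<lparr>carrier := B\<rparr>\<^esub> A = insert A Y"
  proof -
    have "rcosets\<^bsub>G\<lparr>carrier := B\<rparr>\<^esub> A = (\<lambda>x. A #> x) ` B"
      by (auto simp: RCOSETS_def r_coset_def)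
    also have "\<dots> = (\<lambda>x. A #> x) ` A \<union> Y" using \<open>A \<subset> B\<close> by (auto simp: Y_def)
    also have "(\<lambda>x. A #> x) ` A = {A}"
    proof -
      have "A #> a = A" if "a \<in> A" for a using that coset_join2[OF _ A] A.mem_carrier by blast
      then show ?thesis using A.one_closed by (auto intro!: image_eqI[of _ _ \<one>])
    qed
    finally show ?thesis by simp
  qed
  moreover have "A \<notin> Y"
    using rcos_self[OF _ A] by (auto simp: Y_def)
  ultimately have index: "card (rcosets\<^bsub>G\<lparr>carrier := B\<rparr>\<^esub> A) = Suc (card Y)"
    using finY by simp
  obtain j where j: "card B = p ^ j" using subgroup_card_eq_power[OF B] .
  have lag: "Suc (card Y) * card A = p ^ j"
    using GB.lagrange[OF AB] index j by (simp add: order_def)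
  have "\<not> p dvd card Y"
  proof
    assume "p dvd card Y"
    have "Suc (card Y) \<noteq> 1" using lag j \<open>A \<subset> B\<close> finB by (metis One_nat_def mult_1 psubset_card_mono nat_neq_iff)
    moreover have "Suc (card Y) dvd p ^ j" using lag by (metis dvd_triv_left)
    ultimately have "p dvd Suc (card Y)"
      using prime_p by (metis divides_primepow_nat dvd_power gr0I power_0)
    with \<open>p dvd card Y\<close> have "p dvd 1" by (metis Suc_eq_plus1 dvd_add_right_iff)
    then show False using prime_p by simp
  qed
  have YE: "f e Z \<in> Y" if "e \<in> E" "Z \<in> Y" for e Z
  proof -
    obtain x where x: "Z = A #> x" "x \<in> B" "x \<notin> A" using \<open>Z \<in> Y\<close> by (auto simp: Y_def)
    have e: "e \<in> carrier G" "inv e \<in> E" using that by auto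
    have "cj x (inv e) \<in> B" using x e cjB by blast
    moreover have "cj x (inv e) \<notin> A"
    proof
      assume "cj x (inv e) \<in> A"
      then have "cj (cj x (inv e)) e \<in> A" using cjA that by blast
      then show False using x e by simp
    qed
    ultimately show ?thesis using f_coset that x by (auto simp: Y_def)
  qed
  have Ycar: "Z \<subseteq> carrier G" if "Z \<in> Y" for Z
    using that r_coset_subset_G[OF A.subset] B.subset unfolding Y_def by blast
  have "group_action (G\<lparr>carrier := E\<rparr>) Y (\<lambda>e. \<lambda>Z\<in>Y. f e Z)"
  proof (rule GE.group_actionI)
    show "f \<one>\<^bsub>G\<lparr>carrier := E\<rparr>\<^esub> Z = Z" if "Z \<in> Y" for Z
      using Ycar[OF that] by (force simp: f_def)
    show "f (g \<otimes>\<^bsub>G\<lparr>carrier := E\<rparr>\<^esub> h) Z = f g (f h Z)"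
      if "g \<in> carrier (G\<lparr>carrier := E\<rparr>)" "h \<in> carrier (G\<lparr>carrier := E\<rparr>)" "Z \<in> Y" for g h Z
    proof -
      have gh: "g \<in> carrier G" "h \<in> carrier G" using that by auto
      have "cj x (inv (g \<otimes> h)) = cj (cj x (inv h)) (inv g)" if "x \<in> Z" for x
      proof -
        have "x \<in> carrier G" using that Ycar[OF \<open>Z \<in> Y\<close>] by blast
        then show ?thesis using gh by (simp add: cj_cj inv_mult_group)
      qed
      then show ?thesis by (auto simp: f_def image_image)
    qed
  qed (simp add: YE)
  then interpret act: group_action "G\<lparr>carrier := E\<rparr>" Y "\<lambda>e. \<lambda>Z\<in>Y. f e Z" .
  obtain i where "order (G\<lparr>carrier := E\<rparr>) = p ^ i"
    using subgroup_card_eq_power[OF E] by (auto simp: order_def)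
  from act.p_group_fixed_point[OF prime_p this finY \<open>\<not> p dvd card Y\<close>]
  obtain Z where Z: "Z \<in> Y" "\<And>e. e \<in> E \<Longrightarrow> f e Z = Z" by auto
  obtain x where x: "Z = A #> x" "x \<in> B" "x \<notin> A" using Z(1) by (auto simp: Y_def)
  have xG: "x \<in> carrier G" using x(2) by simp
  \<comment> \<open>A fixed right coset \<open>A #> x\<close> is the fixed left coset of \<open>inv x\<close>, which is what \<open>comm\<close> sees.\<close>
  have "inv x \<in> B - A" using x xG by (metis A.m_inv_closed B.m_inv_closed Diff_iff inv_inv)
  moreover have "comm (inv x) e \<in> A" if "e \<in> E" for e
  proof -
    have e: "e \<in> carrier G" "inv e \<in> E" using that by auto
    have "cj x e \<in> f (inv e) Z"
      using e xG rcos_self[OF xG A] x(1) by (auto simp: f_def)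
    then obtain a where a: "a \<in> A" "cj x e = a \<otimes> x"
      using Z(2)[OF e(2)] x(1) by (auto simp: r_coset_def)
    have "comm (inv x) e = x \<otimes> inv (cj x e)" using xG e by (simp add: comm_eq_cj cj_inv)
    also have "\<dots> = inv a" using a xG by (simp add: inv_mult_group)
    finally show ?thesis using a by simp
  qed
  ultimately show ?thesis by blast
qed

end

section \<open>Elementary abelian subgroups and Thompson replacement\<close>

context group begin

lemma elementary_abelian_iff:
  "elementary_abelian p G E \<longleftrightarrow>
    subgroup E G \<and> (\<forall>x\<in>E. \<forall>y\<in>E. x \<otimes> y = y \<otimes> x) \<and> (\<forall>x\<in>E. x [^] p = \<one>)"
proof -
  have "comm_group (G\<lparr>carrier := E\<rparr>) \<longleftrightarrow> (\<forall>x\<in>E. \<forall>y\<in>E. x \<otimes> y = y \<otimes> x)" if "subgroup E G"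
  proof
    show "\<forall>x\<in>E. \<forall>y\<in>E. x \<otimes> y = y \<otimes> x" if "comm_group (G\<lparr>carrier := E\<rparr>)"
      using comm_monoid.m_comm[OF comm_group.axioms(1)[OF that]] by simp
    show "comm_group (G\<lparr>carrier := E\<rparr>)" if "\<forall>x\<in>E. \<forall>y\<in>E. x \<otimes> y = y \<otimes> x"
      by (rule group.group_comm_groupI[OF subgroup_imp_group[OF \<open>subgroup E G\<close>]]) (use that in auto)
  qed
  then show ?thesis by (auto simp: elementary_abelian_def)
qed

lemma elementary_abelian_subset:
  "elementary_abelian p G E \<Longrightarrow> subgroup F G \<Longrightarrow> F \<subseteq> E \<Longrightarrow> elementary_abelian p G F"
  unfolding elementary_abelian_iff by blast

lemma elementary_abelian_set_mult:
  assumes A: "elementary_abelian p G A" and B: "elementary_abelian p G B"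
    and comm: "\<And>a b. a \<in> A \<Longrightarrow> b \<in> B \<Longrightarrow> a \<otimes> b = b \<otimes> a"
  shows "elementary_abelian p G (A <#> B)"
proof -
  interpret A: subgroup A G using A by (simp add: elementary_abelian_iff)
  interpret B: subgroup B G using B by (simp add: elementary_abelian_iff)
  have mult: "(a \<otimes> b) \<otimes> (a' \<otimes> b') = (a \<otimes> a') \<otimes> (b \<otimes> b')"
    if "a \<in> A" "b \<in> B" "a' \<in> A" "b' \<in> B" for a b a' b'
  proof -
    have c: "a \<in> carrier G" "b \<in> carrier G" "a' \<in> carrier G" "b' \<in> carrier G" using that by auto
    then have "(a \<otimes> b) \<otimes> (a' \<otimes> b') = a \<otimes> (b \<otimes> a') \<otimes> b'" by (simp add: m_assoc)
    also have "b \<otimes> a' = a' \<otimes> b" using comm[of a' b] that by simp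
    finally show ?thesis using c by (simp add: m_assoc)
  qed
  have inv: "inv (a \<otimes> b) = inv a \<otimes> inv b" if "a \<in> A" "b \<in> B" for a b
    using that comm[of "inv a" "inv b"] by (simp add: inv_mult_group)
  have "subgroup (A <#> B) G"
  proof (rule subgroupI)
    show "A <#> B \<subseteq> carrier G" by (auto simp: set_mult_def)
    show "A <#> B \<noteq> {}" using A.one_closed B.one_closed unfolding set_mult_def by blast
    show "inv x \<in> A <#> B" if "x \<in> A <#> B" for x
      using that inv by (fastforce simp: set_mult_def)
    show "x \<otimes> y \<in> A <#> B" if "x \<in> A <#> B" "y \<in> A <#> B" for x y
      using that mult by (fastforce simp: set_mult_def)
  qed
  moreover have "x \<otimes> y = y \<otimes> x" if "x \<in> A <#> B" "y \<in> A <#> B" for x y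
  proof -
    obtain a b a' b' where ab: "x = a \<otimes> b" "y = a' \<otimes> b'" "a \<in> A" "b \<in> B" "a' \<in> A" "b' \<in> B"
      using \<open>x \<in> A <#> B\<close> \<open>y \<in> A <#> B\<close> by (auto simp: set_mult_def)
    then have "a \<otimes> a' = a' \<otimes> a" "b \<otimes> b' = b' \<otimes> b"
      using A B by (simp_all add: elementary_abelian_iff)
    then show ?thesis using ab mult by simp
  qed
  moreover have "x [^] p = \<one>" if "x \<in> A <#> B" for x
  proof -
    obtain a b where ab: "x = a \<otimes> b" "a \<in> A" "b \<in> B" using \<open>x \<in> A <#> B\<close> by (auto simp: set_mult_def)
    then show ?thesis
      using comm[of a b] A B pow_mult_distrib[of a b p] by (simp add: elementary_abelian_iff)
  qed
  ultimately show ?thesis by (auto simp: elementary_abelian_iff)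
qed

lemma elementary_abelian_generate:
  assumes "A \<subseteq> carrier G" "\<And>a b. a \<in> A \<Longrightarrow> b \<in> A \<Longrightarrow> a \<otimes> b = b \<otimes> a"
    and "\<And>a. a \<in> A \<Longrightarrow> a [^] p = \<one>"
  shows "elementary_abelian p G (generate G A)"
proof -
  have comm: "x \<otimes> y = y \<otimes> x" if "x \<in> generate G A" "y \<in> generate G A" for x y
    using generate_commute[OF assms(1,2)] that by blast
  have "x [^] p = \<one>" if "x \<in> generate G A" for x
    using that
  proof (induction rule: generate.induct)
    case (incl h) then show ?case using assms(3) by blast
  next
    case (inv h) then show ?case using assms(1,3) by (simp add: subset_iff nat_pow_inv)
  next
    case (eng x y)
    then have "x \<in> carrier G" "y \<in> carrier G" using generate_in_carrier[OF assms(1)] by blast+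
    then show ?case using eng comm[of x y] by (simp add: pow_mult_distrib)
  qed simp
  then show ?thesis using comm generate_is_subgroup[OF assms(1)] by (simp add: elementary_abelian_iff)
qed

lemma elementary_abelian_triv: "elementary_abelian p G {\<one>}"
  by (simp add: elementary_abelian_iff triv_subgroup)

definition quadratic :: "'a set \<Rightarrow> 'a set" where
  "quadratic W = {x \<in> carrier G. \<forall>w\<in>W. comm (comm w x) x = \<one>}"

end

context p_group begin

text \<open>
  Otherwise the product of \<open>E\<close> and \<open>F\<close> would be a larger elementary abelian subgroup.
\<close>

lemma max_elementary_abelian_absorbs:
  assumes E: "max_elementary_abelian p G E" and F: "elementary_abelian p G F"
    and comm: "F \<subseteq> centralizer G E"
  shows "F \<subseteq> E"
proof -
  have E': "elementary_abelian p G E" using E by (simp add: max_elementary_abelian_def)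
  then have subs: "subgroup E G" "subgroup F G" using F by (auto simp: elementary_abelian_iff)
  have EF: "elementary_abelian p G (E <#> F)"
    by (rule elementary_abelian_set_mult[OF E' F]) (use comm in \<open>auto simp: centralizer_def\<close>)
  then have fin: "finite (E <#> F)"
    using finite_subset_carrier subgroup.subset by (auto simp: elementary_abelian_iff)
  have "e \<otimes> \<one> \<in> E <#> F" if "e \<in> E" for e
    using that subgroup.one_closed[OF subs(2)] by (auto simp: set_mult_def)
  then have "E \<subseteq> E <#> F" using subgroup.mem_carrier[OF subs(1)] by auto
  moreover have "card (E <#> F) \<le> card E" using E EF by (simp add: max_elementary_abelian_def)
  ultimately have "E = E <#> F" using fin card_seteq by blast
  moreover have "\<one> \<otimes> f \<in> E <#> F" if "f \<in> F" for f
    using that subgroup.one_closed[OF subs(1)] by (auto simp: set_mult_def)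
  ultimately show ?thesis using subgroup.mem_carrier[OF subs(2)] by auto
qed

lemma card_elementary_abelian_le: "elementary_abelian p G E \<Longrightarrow> card E \<le> card (carrier G)"
  by (auto simp: elementary_abelian_iff intro!: card_mono dest: subgroup.subset)

lemma ex_max_elementary_abelian: "\<exists>E. max_elementary_abelian p G E"
  using ex_has_greatest_nat[of "elementary_abelian p G", OF elementary_abelian_triv, of card "Suc (card (carrier G))"]
    card_elementary_abelian_le by (auto simp: max_elementary_abelian_def less_Suc_eq_le)

text \<open>
  Thompson's replacement argument. Among the elementary abelian subgroups of maximal order that act
  nontrivially on \<open>W\<close>, choose \<open>E\<close> with \<open>E \<inter> W\<close> as large as possible; the claim is that \<open>[W,E,E] = 1\<close>, so every
  element of \<open>E\<close> outside \<open>C(W)\<close> is as required. Let \<open>W\<^sub>2\<close> be the set of all \<open>w \<in> W\<close> with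
  \<open>[w,E,E] = 1\<close>. If \<open>W\<^sub>2 \<noteq> W\<close>, there is \<open>w \<in> W - W\<^sub>2\<close> with \<open>[w,E] \<le> W\<^sub>2\<close>. Put \<open>M = [w,E]\<close> and
  \<open>C = C\<^sub>E(M)\<close>. Then \<open>M C\<close> is elementary abelian, at least as large as \<open>E\<close>, and meets \<open>W\<close> in a larger
  subgroup than \<open>E\<close> does. By the choice of \<open>E\<close> it centralizes \<open>W\<close>, and by maximality it contains \<open>W\<close>.
  But then \<open>w = m c\<close> with \<open>m \<in> M \<le> W\<^sub>2\<close> and \<open>c \<in> W \<inter> E \<le> W\<^sub>2\<close>, so that \<open>w \<in> W\<^sub>2\<close> after all.
  
  The choice of \<open>w\<close> just above \<open>W\<^sub>2\<close> is what excludes that \<open>M C\<close> acts trivially on \<open>W\<close>, the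
  case in which replacement would lose the quadratic element.
\<close>

theorem ex_quadratic_on_normal:
  assumes W: "elementary_abelian p G W" "W \<lhd> G"
    and E0: "max_elementary_abelian p G E0" "\<not> E0 \<subseteq> centralizer G W"
  shows "\<exists>x \<in> quadratic W. x \<notin> centralizer G W"
proof -
  interpret W: subgroup W G using W(1) by (simp add: elementary_abelian_iff)
  have Wcomm: "u \<otimes> v = v \<otimes> u" if "u \<in> W" "v \<in> W" for u v
    using W(1) that by (simp add: elementary_abelian_iff)
  have finW: "finite W" by (simp add: finite_subset_carrier W.subset)
  obtain E where E: "max_elementary_abelian p G E" "\<not> E \<subseteq> centralizer G W"
    and Emax: "\<And>F. max_elementary_abelian p G F \<Longrightarrow> \<not> F \<subseteq> centralizer G W \<Longrightarrow>
      card (F \<inter> W) \<le> card (E \<inter> W)"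
    using ex_has_greatest_nat[of "\<lambda>E. max_elementary_abelian p G E \<and> \<not> E \<subseteq> centralizer G W" E0
        "\<lambda>E. card (E \<inter> W)" "Suc (card W)"] E0 finW
    by (auto simp: card_mono less_Suc_eq_le)
  have Eab: "elementary_abelian p G E" using E(1) by (simp add: max_elementary_abelian_def)
  interpret E: subgroup E G using Eab by (simp add: elementary_abelian_iff)
  have Ecomm: "u \<otimes> v = v \<otimes> u" if "u \<in> E" "v \<in> E" for u v
    using Eab that by (simp add: elementary_abelian_iff)
  have Ecj: "cj u v = u" if "u \<in> E" "v \<in> E" for u v
    using that Ecomm[OF that] by (simp add: cj_eq_iff)
  have commW: "comm w x \<in> W" if "w \<in> W" "x \<in> carrier G" for w x
    using normal_comm_closed[OF W(2) that] .
  have comm_mult: "comm (u \<otimes> v) x = comm u x \<otimes> comm v x" if "u \<in> W" "v \<in> W" "x \<in> carrier G" for u v x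
    using that comm_mult_left[of u v x] Wcomm commW by auto
  define W2 where "W2 = {w \<in> W. \<forall>e\<in>E. \<forall>f\<in>E. comm (comm w e) f = \<one>}"
  have W2iff: "w \<in> W2 \<longleftrightarrow> w \<in> W \<and> (\<forall>e\<in>E. comm w e \<in> centralizer G E)" for w
    by (auto simp: W2_def centralizer_def comm_eq_one_iff commW)
  have subCE: "subgroup (centralizer G E) G" by (rule subgroup_centralizer[OF E.subset])
  have subW2: "subgroup W2 G"
  proof (rule subgroupI)
    show "W2 \<subseteq> carrier G" by (auto simp: W2_def)
    have "\<one> \<in> W2" by (auto simp: W2_def comm_def)
    then show "W2 \<noteq> {}" by blast
    show "inv u \<in> W2" if "u \<in> W2" for u
    proof -
      have "inv u \<in> W" using that by (simp add: W2_def)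
      moreover have "comm (inv u) e \<in> centralizer G E" if e: "e \<in> E" for e
      proof -
        have u: "u \<in> W" "comm u e \<in> centralizer G E" using \<open>u \<in> W2\<close> e W2iff by blast+
        have "comm (inv u) e = inv (comm u e)"
          by (rule comm_inv_left) (use u(1) e Wcomm commW in auto)
        then show ?thesis using u(2) subgroup.m_inv_closed[OF subCE] by simp
      qed
      ultimately show ?thesis using W2iff by blast
    qed
    show "u \<otimes> v \<in> W2" if "u \<in> W2" "v \<in> W2" for u v
    proof -
      have uv: "u \<in> W" "v \<in> W" using that W2iff by blast+
      have "comm (u \<otimes> v) e \<in> centralizer G E" if e: "e \<in> E" for e
      proof -
        have "comm u e \<in> centralizer G E" "comm v e \<in> centralizer G E"
          using \<open>u \<in> W2\<close> \<open>v \<in> W2\<close> e W2iff by blast+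
        then show ?thesis using comm_mult[OF uv] e subgroup.m_closed[OF subCE] by simp
      qed
      then show ?thesis using uv W2iff by simp
    qed
  qed
  have "W2 = W"
  proof (rule ccontr)
    assume "W2 \<noteq> W"
    then have "W2 \<subset> W" by (auto simp: W2_def)
    have cjW2: "cj u e \<in> W2" if "u \<in> W2" "e \<in> E" for u e
    proof -
      have uW: "u \<in> W" using \<open>u \<in> W2\<close> W2iff by blast
      have eq: "comm (cj u e) f = comm u f" if "f \<in> E" for f
      proof -
        have "comm (cj u e) f = cj (comm u f) e"
          using uW \<open>e \<in> E\<close> that by (simp add: cj_comm Ecj)
        moreover have "comm u f \<otimes> e = e \<otimes> comm u f"
          using \<open>u \<in> W2\<close> \<open>e \<in> E\<close> that unfolding W2iff centralizer_def by blast
        moreover have "comm u f \<in> carrier G" "e \<in> carrier G"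
          using uW \<open>e \<in> E\<close> that by simp_all
        ultimately show ?thesis using cj_eq_iff by metis
      qed
      have "comm (cj u e) f \<in> centralizer G E" if f: "f \<in> E" for f
        unfolding eq[OF f] using iffD1[OF W2iff \<open>u \<in> W2\<close>] f by blast
      moreover have "cj u e \<in> W" using normal_cj_closed[OF W(2) uW] \<open>e \<in> E\<close> by simp
      ultimately show ?thesis unfolding W2iff by (intro conjI ballI)
    qed
    have "cj u e \<in> W" if "u \<in> W" "e \<in> E" for u e using normal_cj_closed[OF W(2)] that by simp
    from ex_fixed_coset[OF subW2 W.subgroup_axioms E.subgroup_axioms \<open>W2 \<subset> W\<close> cjW2 this]
    obtain w where w: "w \<in> W" "w \<notin> W2" "\<And>e. e \<in> E \<Longrightarrow> comm w e \<in> W2" by blast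
    have wG: "w \<in> carrier G" using w(1) by simp
    define M0 where "M0 = comm w ` E"
    define M where "M = generate G M0"
    define C where "C = E \<inter> centralizer G M0"
    have M0W: "M0 \<subseteq> W" using w(1) commW by (auto simp: M0_def)
    then have M0G: "M0 \<subseteq> carrier G" using W.subset by blast
    have subM: "subgroup M G" unfolding M_def using M0G by (rule generate_is_subgroup)
    have subC: "subgroup C G" unfolding C_def
      by (intro subgroups_Inter_pair E.subgroup_axioms subgroup_centralizer M0G)
    interpret C: subgroup C G by (rule subC)
    have MW: "M \<subseteq> W" unfolding M_def using M0W W.subgroup_axioms by (rule generate_subgroup_incl)
    have MW2: "M \<subseteq> W2" unfolding M_def using w(3) subW2 by (intro generate_subgroup_incl) (auto simp: M0_def)
    have "M \<subseteq> centralizer G C" unfolding M_def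
    proof (rule generate_subgroup_incl)
      show "M0 \<subseteq> centralizer G C" using M0G by (rule centralizer_swap) (simp add: C_def)
    qed (rule subgroup_centralizer[OF C.subset])
    then have MC: "m \<otimes> c = c \<otimes> m" if "m \<in> M" "c \<in> C" for m c
      using that centralizerD by (metis subsetD)
    moreover have "elementary_abelian p G M" using elementary_abelian_subset[OF W(1) subM MW] .
    moreover have "elementary_abelian p G C" using elementary_abelian_subset[OF Eab subC] by (simp add: C_def)
    ultimately have E'ab: "elementary_abelian p G (M <#> C)"
      by (intro elementary_abelian_set_mult)
    then have finE': "finite (M <#> C)"
      using finite_subset_carrier subgroup.subset by (auto simp: elementary_abelian_iff)
    \<comment> \<open>Modulo \<open>C\<close>, the map from \<open>x\<close> to \<open>[w,x]\<close> is injective on \<open>E\<close>: this is what makes \<open>M C\<close> as large as \<open>E\<close>.\<close>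
    have key: "x \<otimes> inv y \<in> C"
      if "x \<in> E" "y \<in> E" "k \<in> C" "comm w x = comm w y \<otimes> k" for x y k
    proof -
      have G: "x \<in> carrier G" "y \<in> carrier G" "k \<in> carrier G" using that by auto
      have kE: "k \<in> E" using that by (simp add: C_def)
      have "k = inv (comm w y) \<otimes> comm w x"
        unfolding that(4) using G wG by simp
      then have kW: "k \<in> W" using commW w(1) G by simp
      have "cj w x = cj w y \<otimes> k" using that(4) G wG by (simp add: cj_eq_comm m_assoc)
      then have "cj w (x \<otimes> inv y) = cj (cj w y \<otimes> k) (inv y)" using G wG by (simp flip: cj_cj)
      also have "\<dots> = w \<otimes> k" using G wG Ecj[OF kE, of "inv y"] that by (simp add: cj_mult)
      finally have wt: "cj w (x \<otimes> inv y) = w \<otimes> k" .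
      have t: "x \<otimes> inv y \<in> E" using that by simp
      have "(x \<otimes> inv y) \<otimes> m = m \<otimes> (x \<otimes> inv y)" if "m \<in> M0" for m
      proof -
        obtain e where e: "e \<in> E" "m = comm w e" using \<open>m \<in> M0\<close> by (auto simp: M0_def)
        have "cj m (x \<otimes> inv y) = comm (cj w (x \<otimes> inv y)) (cj e (x \<otimes> inv y))"
          using e wG t by (simp add: cj_comm)
        also have "\<dots> = comm (w \<otimes> k) e" using e t wt Ecj by simp
        also have "\<dots> = comm w e \<otimes> comm k e" using comm_mult w(1) kW e by simp
        also have "comm k e = \<one>" using kE e Ecomm by (simp add: comm_eq_one_iff)
        finally have "cj m (x \<otimes> inv y) = m" using e wG by simp
        then show ?thesis using cj_eq_iff[of m "x \<otimes> inv y"] e wG t by auto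
      qed
      then show ?thesis using t unfolding C_def by (intro IntI centralizerI) auto
    qed
    \<comment> \<open>An injection of \<open>E\<close> into \<open>M C\<close>: split \<open>e\<close> into the chosen representative \<open>r e\<close> of its coset of \<open>C\<close>
      and an element of \<open>C\<close>, and replace \<open>r e\<close> by \<open>[w, r e]\<close>.\<close>
    define r where "r e = (SOME y. y \<in> C #> e)" for e
    have r: "r e \<in> C #> e" if "e \<in> E" for e
      unfolding r_def using rcos_self[OF _ subC] that by (metis E.mem_carrier someI_ex)
    have rE: "r e \<in> E" and rd: "inv (r e) \<otimes> e \<in> C" if "e \<in> E" for e
    proof -
      obtain c where c: "c \<in> C" "r e = c \<otimes> e" using r[OF \<open>e \<in> E\<close>] by (auto simp: r_coset_def)
      have cE: "c \<in> E" using c by (simp add: C_def)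
      show "r e \<in> E" using c cE that by simp
      have "inv (r e) \<otimes> e = cj (inv c) e" using c cE that by (simp add: cj_def inv_mult_group)
      also have "\<dots> = inv c" using Ecj cE that by simp
      finally show "inv (r e) \<otimes> e \<in> C" using c by simp
    qed
    have "inj_on (\<lambda>e. comm w (r e) \<otimes> (inv (r e) \<otimes> e)) E"
    proof (rule inj_onI)
      fix e f assume e: "e \<in> E" and f: "f \<in> E"
        and eq: "comm w (r e) \<otimes> (inv (r e) \<otimes> e) = comm w (r f) \<otimes> (inv (r f) \<otimes> f)"
      let ?d = "inv (r e) \<otimes> e" and ?d' = "inv (r f) \<otimes> f"
      have G: "comm w (r e) \<in> carrier G" "comm w (r f) \<in> carrier G" "?d \<in> carrier G" "?d' \<in> carrier G"
        using e f rE wG by auto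
      have "comm w (r e) = comm w (r e) \<otimes> ?d \<otimes> inv ?d" using G by (simp add: m_assoc del: inv_mult_group)
      also have "\<dots> = comm w (r f) \<otimes> (?d' \<otimes> inv ?d)" unfolding eq using G by (simp add: m_assoc)
      finally have "r e \<otimes> inv (r f) \<in> C"
        using key[OF rE rE, of e f "?d' \<otimes> inv ?d"] e f rd by (metis C.m_closed C.m_inv_closed)
      then have "r e \<in> C #> r f"
        using rE[OF e] rE[OF f] unfolding r_coset_def by (auto intro!: bexI[of _ "r e \<otimes> inv (r f)"] simp: m_assoc)
      then have "C #> r e = C #> r f" using repr_independence[OF _ _ subC] rE[OF f] by simp
      moreover have "C #> r e = C #> e" "C #> r f = C #> f"
        using repr_independence[OF r _ subC] e f by auto
      ultimately have "r e = r f" by (simp add: r_def)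
      then show "e = f" using eq e f rE[of f] wG by simp
    qed
    moreover have "(\<lambda>e. comm w (r e) \<otimes> (inv (r e) \<otimes> e)) ` E \<subseteq> M <#> C"
      using rE rd unfolding M_def by (fastforce simp: set_mult_def M0_def intro: generate.incl)
    ultimately have "card E \<le> card (M <#> C)" using finE' card_inj_on_le by blast
    then have E'max: "max_elementary_abelian p G (M <#> C)"
      using E(1) E'ab le_trans by (auto simp: max_elementary_abelian_def)
    have Msub: "M \<subseteq> M <#> C"
    proof
      fix m assume m: "m \<in> M"
      then have "m \<otimes> \<one> \<in> M <#> C" unfolding set_mult_def using C.one_closed by blast
      then show "m \<in> M <#> C" using m MW by auto
    qed
    have "E \<inter> W \<subseteq> C" unfolding C_def
    proof (intro subsetI IntI centralizerI)
      fix u m assume "u \<in> E \<inter> W" "m \<in> M0"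
      then show "u \<otimes> m = m \<otimes> u" using Wcomm M0W by blast
    qed auto
    moreover have "c \<in> M <#> C" if "c \<in> C" for c
    proof -
      have "\<one> \<otimes> c \<in> M <#> C" unfolding set_mult_def using that subgroup.one_closed[OF subM] by blast
      then show ?thesis using that by simp
    qed
    ultimately have "E \<inter> W \<subseteq> (M <#> C) \<inter> W" by blast
    moreover obtain e f where ef: "e \<in> E" "f \<in> E" "comm (comm w e) f \<noteq> \<one>"
      using w(1,2) by (auto simp: W2_def)
    have "comm w e \<in> (M <#> C) \<inter> W"
      using Msub ef commW w(1) by (auto simp: M_def M0_def intro!: generate.incl)
    moreover have "comm w e \<notin> E"
      using ef Ecomm wG by (auto simp: comm_eq_one_iff)
    ultimately have "E \<inter> W \<subset> (M <#> C) \<inter> W" by blast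
    then have "card (E \<inter> W) < card ((M <#> C) \<inter> W)" using finE' by (simp add: psubset_card_mono)
    then have "M <#> C \<subseteq> centralizer G W" using Emax[OF E'max] by linarith
    then have "W \<subseteq> centralizer G (M <#> C)" by (rule centralizer_swap[OF W.subset])
    then have "W \<subseteq> M <#> C" using max_elementary_abelian_absorbs[OF E'max W(1)] by blast
    then obtain m c where mc: "m \<in> M" "c \<in> C" "w = m \<otimes> c" using w(1) by (auto simp: set_mult_def)
    have mG: "m \<in> W" "c \<in> carrier G" using mc MW by auto
    have "c = inv m \<otimes> w" using mc mG by simp
    then have "c \<in> W" using w(1) mG by simp
    moreover have "comm c e = \<one>" if "e \<in> E" for e
      using that Ecomm mc by (auto simp: C_def comm_eq_one_iff)
    ultimately have "c \<in> W2" using subgroup.one_closed[OF subCE] by (simp add: W2iff)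
    then show False using w(2) mc MW2 subgroup.m_closed[OF subW2] by blast
  qed
  obtain x where x: "x \<in> E" "x \<notin> centralizer G W" using E(2) by blast
  have "x \<in> quadratic W" using \<open>W2 = W\<close> x by (auto simp: quadratic_def W2_def)
  then show ?thesis using x by blast
qed

end

section \<open>Quadratic action on an elementary abelian normal subgroup\<close>

text \<open>
  The calculation behind \<open>quadratic_commutator\<close>, with the group action stripped off: multiply
  the first and the last relation and compare with the product of the other two.
\<close>

lemma (in comm_group) square_relations:
  assumes "a \<in> carrier G" "a' \<in> carrier G" "u \<in> carrier G" "z \<in> carrier G"
    "b \<in> carrier G" "d \<in> carrier G" "e \<in> carrier G"
    and "a \<otimes> u = b \<otimes> b" "a \<otimes> z = d \<otimes> d" "a' \<otimes> u = d \<otimes> d" "a' \<otimes> z = e \<otimes> e"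
  shows "(b \<otimes> e) \<otimes> (b \<otimes> e) = (d \<otimes> d) \<otimes> (d \<otimes> d)"
proof -
  have "(b \<otimes> e) \<otimes> (b \<otimes> e) = (b \<otimes> b) \<otimes> (e \<otimes> e)" using assms(1-7) by (simp add: m_ac)
  also have "\<dots> = (a \<otimes> u) \<otimes> (a' \<otimes> z)" using assms(8,11) by simp
  also have "\<dots> = (a \<otimes> z) \<otimes> (a' \<otimes> u)" using assms(1-7) by (simp add: m_ac)
  finally show ?thesis using assms(9,10) by simp
qed

text \<open>
  Squaring is invertible on elements of odd exponent: the inverse is raising to the power \<open>(p + 1)/2\<close>.
\<close>

lemma (in group) square_inject:
  assumes "odd (p::nat)" "x \<in> carrier G" "y \<in> carrier G" "x [^] p = \<one>" "y [^] p = \<one>"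
    and "x \<otimes> x = y \<otimes> y"
  shows "x = y"
proof -
  obtain n where n: "Suc p = 2 * n" using \<open>odd p\<close> by (metis dvdE even_Suc)
  have "w = (w \<otimes> w) [^] n" if "w \<in> carrier G" "w [^] p = \<one>" for w
  proof -
    have "w = w [^] Suc p" using that by simp
    also have "\<dots> = (w [^] (2::nat)) [^] n" using that n by (simp add: nat_pow_pow)
    finally show ?thesis using that by (simp add: numeral_2_eq_2)
  qed
  then show ?thesis using assms by metis
qed

context group begin

lemma quadratic_cj:
  assumes W: "W \<lhd> G" and b: "b \<in> quadratic W" and g: "g \<in> carrier G"
  shows "cj b g \<in> quadratic W"
proof -
  have bG: "b \<in> carrier G" using b by (simp add: quadratic_def)
  have "comm (comm w (cj b g)) (cj b g) = \<one>" if w: "w \<in> W" for w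
  proof -
    have wG: "w \<in> carrier G" using w W by (meson normal_imp_subgroup subgroup.mem_carrier)
    have "comm (comm (cj w (inv g)) b) b = \<one>"
      using b normal_cj_closed[OF W w, of "inv g"] g by (simp add: quadratic_def)
    then have "cj (comm (comm (cj w (inv g)) b) b) g = \<one>" using g by simp
    then show ?thesis using wG bG g by (simp add: cj_comm)
  qed
  then show ?thesis using bG g by (simp add: quadratic_def)
qed

text \<open>
  In additive notation for \<open>W\<close>, with \<open>x\<close> acting as an endomorphism, both sides say that
  \<open>x\<^sup>2 - 2x + 1 = 0\<close>.
\<close>

lemma quadratic_iff:
  assumes W: "W \<lhd> G" and ab: "\<And>u v. u \<in> W \<Longrightarrow> v \<in> W \<Longrightarrow> u \<otimes> v = v \<otimes> u"
  shows "x \<in> quadratic W \<longleftrightarrow>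
    x \<in> carrier G \<and> (\<forall>w\<in>W. cj (cj w x) x \<otimes> w = cj w x \<otimes> cj w x)"
proof -
  have "comm (comm w x) x = \<one> \<longleftrightarrow> cj (cj w x) x \<otimes> w = cj w x \<otimes> cj w x"
    if x: "x \<in> carrier G" and w: "w \<in> W" for w
  proof -
    let ?v = "cj w x" and ?z = "cj (cj w x) x"
    have vW: "?v \<in> W" using normal_cj_closed[OF W w x] .
    have G: "w \<in> carrier G" "?v \<in> carrier G" "?z \<in> carrier G"
      using w x W by (auto intro: subgroup.mem_carrier[OF normal_imp_subgroup])
    have "comm (comm w x) x = inv (inv w \<otimes> ?v) \<otimes> (inv ?v \<otimes> ?z)"
      using G x by (simp add: comm_eq_cj cj_mult cj_inv)
    also have "\<dots> = inv ?v \<otimes> (w \<otimes> inv ?v) \<otimes> ?z" using G by (simp add: inv_mult_group m_assoc)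
    also have "w \<otimes> inv ?v = inv ?v \<otimes> w"
      using ab[OF w, of "inv ?v"] vW W by (simp add: normal_imp_subgroup subgroup.m_inv_closed)
    finally have "comm (comm w x) x = inv (?v \<otimes> ?v) \<otimes> (w \<otimes> ?z)"
      using G by (simp add: inv_mult_group m_assoc)
    also have "w \<otimes> ?z = ?z \<otimes> w" using ab[OF w normal_cj_closed[OF W vW x]] .
    finally show ?thesis using G by (metis inv_cancel_left(2) inv_closed l_inv m_closed r_one)
  qed
  then show ?thesis by (auto simp: quadratic_def)
qed

lemma cj_swap_mod_centralizer:
  assumes W: "W \<lhd> G" and w: "w \<in> W" and G: "x \<in> carrier G" "y \<in> carrier G"
    and k: "comm x y \<in> centralizer G W"
  shows "cj (cj w x) y = cj (cj w y) x"
proof -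
  have WG: "W \<subseteq> carrier G" using W by (simp add: normal_imp_subgroup subgroup.subset)
  then have wG: "w \<in> carrier G" using w by blast
  have "x \<otimes> y = y \<otimes> x \<otimes> comm x y" using G by (simp add: comm_def m_assoc)
  then have "cj (cj w x) y = cj (cj (cj w y) x) (comm x y)"
    using wG G by (simp add: cj_cj m_assoc)
  also have "\<dots> = cj (cj w y) x"
    using cj_centralizer[OF WG _ k] normal_cj_closed[OF W] w G by simp
  finally show ?thesis .
qed

text \<open>
  Write \<open>W\<close> additively and let \<open>c = [a,b]\<close>. The conjugates of \<open>b\<close> by \<open>a\<close> and by its inverse are
  quadratic and act on \<open>W\<close> as \<open>b c\<^sup>-\<^sup>1\<close> and \<open>b c\<close>, where \<open>b\<close> and \<open>c\<close> commute as endomorphisms. So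
  \<open>x\<^sup>2 = 2x - 1\<close> holds for \<open>x = b\<close>, \<open>x = b c\<close> and \<open>x = b c\<^sup>-\<^sup>1\<close>. Eliminating \<open>b\<^sup>2\<close> gives
  \<open>2b(c - 1) = c\<^sup>2 - 1 = 2bc(c - 1)\<close>, hence \<open>2b(c - 1)\<^sup>2 = 0\<close>. As \<open>b\<close> is invertible and \<open>W\<close> has odd
  exponent, \<open>(c - 1)\<^sup>2 = 0\<close>.
\<close>

lemma quadratic_commutator:
  assumes W: "W \<lhd> G" "elementary_abelian p G W" and "odd p"
    and b: "b \<in> quadratic W" and a: "a \<in> carrier G"
    and ca: "comm (comm a b) a \<in> centralizer G W" and cb: "comm (comm a b) b \<in> centralizer G W"
  shows "comm a b \<in> quadratic W"
proof -
  interpret W: subgroup W G using W(1) by (rule normal_imp_subgroup)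
  interpret Wab: comm_group "G\<lparr>carrier := W\<rparr>" using W(2) by (simp add: elementary_abelian_def)
  have ab: "u \<otimes> v = v \<otimes> u" if "u \<in> W" "v \<in> W" for u v
    using W(2) that by (simp add: elementary_abelian_iff)
  have Wp: "u [^] p = \<one>" if "u \<in> W" for u
    using W(2) that by (simp add: elementary_abelian_iff)
  have bG: "b \<in> carrier G" using b by (simp add: quadratic_def)
  define c where "c = comm a b"
  have cG: "c \<in> carrier G" using a bG by (simp add: c_def)
  have cjW: "cj u x \<in> W" if "u \<in> W" "x \<in> carrier G" for u x
    using normal_cj_closed[OF W(1) that] .
  have quad: "cj (cj u x) x \<otimes> u = cj u x \<otimes> cj u x" if "x \<in> quadratic W" "u \<in> W" for x u
    using quadratic_iff[OF W(1) ab] that by simp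
  have swap: "cj (cj u c) b = cj (cj u b) c" if "u \<in> W" for u
    using cj_swap_mod_centralizer[OF W(1) that cG bG] cb by (simp add: c_def)
  have swapa: "cj (cj u c) a = cj (cj u a) c" if "u \<in> W" for u
    using cj_swap_mod_centralizer[OF W(1) that cG a] ca by (simp add: c_def)
  have b1: "cj b a = b \<otimes> inv c" using a bG by (simp add: c_def comm_def cj_def m_assoc inv_mult_group)
  have b2: "cj b (inv a) = b \<otimes> (a \<otimes> (c \<otimes> inv a))"
    using a bG by (simp add: c_def comm_def cj_def m_assoc inv_mult_group)
  have act2: "cj u (cj b (inv a)) = cj (cj u b) c" if u: "u \<in> W" for u
  proof -
    have "cj u (cj b (inv a)) = cj (cj (cj (cj u b) a) c) (inv a)"
      unfolding b2 using u bG a cG by (simp add: cj_cj m_assoc)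
    also have "cj (cj (cj u b) a) c = cj (cj (cj u b) c) a"
      using swapa[OF cjW[OF u bG]] by simp
    finally show ?thesis using u bG a cG by simp
  qed
  have "cj (cj u c) c \<otimes> u = cj u c \<otimes> cj u c" if u: "u \<in> W" for u
  proof -
    let ?B = "\<lambda>v. cj v b" and ?C = "\<lambda>v. cj v c"
    have uG: "u \<in> carrier G" using u by simp
    \<comment> \<open>The relations for \<open>b\<close> at \<open>u\<close>, for \<open>b c\<^sup>-\<^sup>1\<close> at \<open>c\<^sup>2u\<close>, for \<open>b c\<close> at \<open>u\<close>, and for \<open>b\<close> at \<open>c\<^sup>2u\<close>.\<close>
    have e1: "?B (?B u) \<otimes> u = ?B u \<otimes> ?B u" using quad[OF b u] .
    have e2: "?B (?B u) \<otimes> ?C (?C u) = ?B (?C u) \<otimes> ?B (?C u)"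
    proof -
      have CC: "?C (?C u) \<in> W" using u cG cjW by simp
      have 1: "cj (?C v) (b \<otimes> inv c) = ?B v" if "v \<in> W" for v
      proof -
        have "cj (?C v) (b \<otimes> inv c) = cj (?C (?B v)) (inv c)"
          using that bG cG by (simp flip: cj_cj add: swap)
        then show ?thesis using that bG cG by simp
      qed
      have 2: "cj (?C (?C u)) (b \<otimes> inv c) = ?B (?C u)" using 1 cjW u cG by simp
      have 3: "cj (?B (?C u)) (b \<otimes> inv c) = ?B (?B u)"
        using 1[OF cjW[OF u bG]] swap[OF u] by simp
      show ?thesis
        using quad[OF quadratic_cj[OF W(1) b a] CC] unfolding b1 2 3 .
    qed
    have e3: "?B (?B (?C (?C u))) \<otimes> u = ?B (?C u) \<otimes> ?B (?C u)"
    proof -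
      have 1: "cj u (cj b (inv a)) = ?B (?C u)" using act2 u swap by simp
      have "cj (?B (?C u)) (cj b (inv a)) = ?C (?B (?B (?C u)))"
        using act2 u cjW bG cG by simp
      also have "\<dots> = ?B (?B (?C (?C u)))" using swap u cjW bG cG by simp
      finally have 2: "cj (?B (?C u)) (cj b (inv a)) = ?B (?B (?C (?C u)))" .
      have "cj b (inv a) \<in> quadratic W" using quadratic_cj[OF W(1) b] a by simp
      from quad[OF this u] show ?thesis unfolding 1 2 .
    qed
    have e4: "?B (?B (?C (?C u))) \<otimes> ?C (?C u) = ?B (?C (?C u)) \<otimes> ?B (?C (?C u))"
      using quad[OF b] u cjW cG by simp
    have "(?B u \<otimes> ?B (?C (?C u))) \<otimes> (?B u \<otimes> ?B (?C (?C u)))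
        = (?B (?C u) \<otimes> ?B (?C u)) \<otimes> (?B (?C u) \<otimes> ?B (?C u))"
      by (rule Wab.square_relations[simplified, OF _ _ _ _ _ _ _ e1 e2 e3 e4])
        (simp_all add: u cjW bG cG)
    from square_inject[OF \<open>odd p\<close> _ _ Wp Wp this]
    have "?B u \<otimes> ?B (?C (?C u)) = ?B (?C u) \<otimes> ?B (?C u)"
      by (simp add: u cjW bG cG)
    then have "?B (u \<otimes> ?C (?C u)) = ?B (?C u \<otimes> ?C u)" using uG bG cG by (simp add: cj_mult)
    then have "u \<otimes> ?C (?C u) = ?C u \<otimes> ?C u" using uG bG cG by (simp add: cj_inject)
    then show ?thesis using ab[OF u, of "?C (?C u)"] cjW u cG by simp
  qed
  then show ?thesis using quadratic_iff[OF W(1) ab] cG by (simp add: c_def)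
qed

text \<open>
  For \<open>u = [w,b]\<close>, which is fixed by \<open>b\<close>, conjugation by \<open>b\<^sup>n\<close> sends \<open>w\<close> to \<open>w u\<^sup>n\<close>.
\<close>

lemma quadratic_power_centralizes:
  assumes W: "W \<lhd> G" "elementary_abelian p G W" and b: "b \<in> quadratic W"
  shows "b [^] p \<in> centralizer G W"
proof (rule centralizerI)
  have bG: "b \<in> carrier G" using b by (simp add: quadratic_def)
  then show "b [^] p \<in> carrier G" by simp
  fix w assume w: "w \<in> W"
  interpret W: subgroup W G using W(1) by (rule normal_imp_subgroup)
  let ?u = "comm w b"
  have uW: "?u \<in> W" using normal_comm_closed[OF W(1) w bG] .
  have ub: "cj ?u b = ?u" using b w bG uW by (simp add: quadratic_def cj_eq_comm)
  have "cj w (b [^] n) = w \<otimes> ?u [^] n" for n :: nat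
  proof (induction n)
    case (Suc n)
    have "cj w (b [^] Suc n) = cj (w \<otimes> ?u [^] n) b" using Suc bG w by (simp flip: cj_cj)
    also have "\<dots> = cj w b \<otimes> cj (?u [^] n) b" using bG w by (simp add: cj_mult)
    also have "cj w b = w \<otimes> ?u" using bG w by (simp add: cj_eq_comm)
    also have "cj (?u [^] n) b = ?u [^] n"
    proof -
      have "b \<otimes> ?u = ?u \<otimes> b" using ub bG w cj_eq_iff[of ?u b] by simp
      then have "?u [^] n \<otimes> b = b \<otimes> ?u [^] n"
        using bG w group_commutes_pow[of ?u b n] by simp
      then show ?thesis using bG w by (simp add: cj_eq_iff)
    qed
    finally have "cj w (b [^] Suc n) = w \<otimes> (?u \<otimes> ?u [^] n)" using bG w by (simp add: m_assoc)
    then show ?case using bG w nat_pow_Suc2[of ?u n] by simp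
  qed (use w in simp)
  then have "cj w (b [^] p) = w" using W(2) uW w by (simp add: elementary_abelian_iff)
  then show "b [^] p \<otimes> w = w \<otimes> b [^] p" using w bG cj_eq_iff[of w "b [^] p"] by simp
qed

end

section \<open>Conjugation-invariant families closed under class-two commutators\<close>

context p_group begin

text \<open>
  The properties of the quadratic elements of a faithful action that survive when the module is
  forgotten. The same notion is applied to \<open>S/X\<close>, acting on \<open>V\<close>, and to \<open>G/C\<^sub>G(W)\<close>, acting on \<open>W\<close>.
\<close>

definition quadratic_family :: "'a set \<Rightarrow> bool" where
  "quadratic_family Q \<longleftrightarrow> Q \<subseteq> carrier G \<and>
     (\<forall>b\<in>Q. \<forall>g\<in>carrier G. cj b g \<in> Q) \<and>
     (\<forall>b\<in>Q. \<forall>a\<in>carrier G. comm (comm a b) a = \<one> \<longrightarrow> comm (comm a b) b = \<one> \<longrightarrow> comm a b \<in> Q) \<and>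
     (\<forall>b\<in>Q. b [^] p = \<one>)"

lemma p_group_quotient:
  assumes "K \<lhd> G"
  shows "p_group (G Mod K) p"
proof -
  interpret K: normal K G by fact
  interpret GK: group "G Mod K" by (rule K.factorgroup_is_group)
  obtain m where m: "order G = p ^ m" using finite_p_group by (auto simp: finite_p_group_def)
  have "card (rcosets K) dvd p ^ m" using lagrange[OF K.subgroup_axioms] m by (metis dvd_triv_left)
  then have "\<exists>j. order (G Mod K) = p ^ j"
    using prime_p by (auto simp: divides_primepow_nat order_def FactGroup_def)
  moreover have "finite (carrier (G Mod K))" by (simp add: carrier_FactGroup)
  ultimately show ?thesis
    using prime_p GK.is_group by unfold_locales (auto simp: finite_p_group_def)
qed

text \<open>
  Let \<open>M\<close> be a largest normal abelian subgroup; it contains its centralizer, since an element of \<open>C(M) - M\<close> that is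
  central modulo \<open>M\<close> would enlarge \<open>M\<close>. Any two elements of \<open>M\<close> commute, so it suffices to find a nontrivial
  member of the family in \<open>M\<close>. If there is none, let \<open>L = C\<^sub>M(b)\<close>. Were \<open>L \<noteq> M\<close>, some \<open>x \<in> M - L\<close>
  would satisfy \<open>[x,b] \<in> L\<close>; then \<open>[x,b]\<close> commutes with \<open>x\<close> and \<open>b\<close> and is a nontrivial member of the
  family in \<open>M\<close>. So \<open>b\<close> centralizes \<open>M\<close> and therefore lies in \<open>M\<close>.
\<close>

lemma quadratic_family_ex_commuting_conjugates:
  assumes Q: "quadratic_family Q" and b: "b \<in> Q" "b \<noteq> \<one>"
  shows "\<exists>e\<in>Q. e \<noteq> \<one> \<and> (\<forall>g\<in>carrier G. e \<otimes> cj e g = cj e g \<otimes> e)"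
proof -
  let ?P = "\<lambda>M. M \<lhd> G \<and> (\<forall>x\<in>M. \<forall>y\<in>M. x \<otimes> y = y \<otimes> x)"
  have QG: "Q \<subseteq> carrier G" using Q by (simp add: quadratic_family_def)
  have bG: "b \<in> carrier G" using b QG by blast
  have le: "card N \<le> card (carrier G)" if "N \<lhd> G" for N
    using that by (intro card_mono) (auto dest: normal_imp_subgroup subgroup.subset)
  have "?P {\<one>}" by (auto intro: normalI_cj triv_subgroup)
  from ex_has_greatest_nat[of ?P, OF this, of card "Suc (card (carrier G))"]
  obtain M where M: "M \<lhd> G" and Mab: "\<And>x y. x \<in> M \<Longrightarrow> y \<in> M \<Longrightarrow> x \<otimes> y = y \<otimes> x"
    and Mmax: "\<And>N. ?P N \<Longrightarrow> card N \<le> card M"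
    using le by (auto simp: less_Suc_eq_le)
  interpret M: normal M G by (rule M)
  show ?thesis
  proof (cases "\<exists>e\<in>Q \<inter> M. e \<noteq> \<one>")
    case True
    then show ?thesis using Mab normal_cj_closed[OF M] by blast
  next
    case False
    then have triv: "e = \<one>" if "e \<in> Q" "e \<in> M" for e using that by blast
    define L where "L = M \<inter> centralizer G {b}"
    have subL: "subgroup L G" unfolding L_def
      using bG by (intro subgroups_Inter_pair M.subgroup_axioms subgroup_centralizer) simp
    have subb: "subgroup (generate G {b}) G" using bG by (intro generate_is_subgroup) simp
    have cjL: "cj x e \<in> L" if x: "x \<in> L" and e: "e \<in> generate G {b}" for x e
    proof -
      have xG: "x \<in> carrier G" using x by (simp add: L_def)
      have "{b} \<subseteq> centralizer G {x}"
        by (rule centralizer_swap) (use x bG in \<open>auto simp: L_def\<close>)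
      then have "generate G {b} \<subseteq> centralizer G {x}"
        using xG by (intro generate_subgroup_incl subgroup_centralizer) auto
      then have "e \<in> carrier G" "x \<otimes> e = e \<otimes> x"
        using e centralizerD[of e "{x}" x] by (auto simp: centralizer_def)
      then show ?thesis using x xG cj_eq_iff[of x e] by simp
    qed
    have cjM: "cj x e \<in> M" if "x \<in> M" "e \<in> generate G {b}" for x e
      using that normal_cj_closed[OF M] subgroup.mem_carrier[OF subb] by simp
    have "L = M"
    proof (rule ccontr)
      assume "L \<noteq> M"
      then have "L \<subset> M" by (auto simp: L_def)
      from ex_fixed_coset[OF subL M.subgroup_axioms subb this cjL cjM]
      obtain x where x: "x \<in> M" "x \<notin> L" "comm x b \<in> L"
        by (meson DiffE generate.incl insertI1)
      have xG: "x \<in> carrier G" using x(1) by simp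
      have "x \<otimes> b = b \<otimes> x"
      proof -
        have c: "comm x b \<in> M" "comm x b \<otimes> b = b \<otimes> comm x b"
          using x(3) centralizerD[of _ "{b}" b] by (auto simp: L_def)
        then have "comm (comm x b) x = \<one>" "comm (comm x b) b = \<one>"
          using Mab[OF c(1) x(1)] xG bG by (simp_all add: comm_eq_one_iff)
        then have "comm x b \<in> Q" using Q b(1) xG by (simp add: quadratic_family_def)
        then have "comm x b = \<one>" using triv c(1) by blast
        then show ?thesis using xG bG by (simp add: comm_eq_one_iff)
      qed
      then show False using x(1,2) xG by (simp add: L_def centralizer_def)
    qed
    define C where "C = centralizer G M"
    have "b \<in> C" unfolding C_def
      using \<open>L = M\<close> centralizer_swap[of M "{b}"] centralizer_swap[of "{b}" M] bG by (auto simp: L_def)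
    have "b \<notin> M" using triv b by blast
    have "M \<subseteq> C" unfolding C_def using Mab by (intro subsetI centralizerI) auto
    then have "M \<subset> C" using \<open>b \<in> C\<close> \<open>b \<notin> M\<close> by blast
    have C: "C \<lhd> G" unfolding C_def by (rule normal_centralizer[OF M])
    from ex_fixed_coset[OF M.subgroup_axioms normal_imp_subgroup[OF C] subgroup_self \<open>M \<subset> C\<close>
        normal_cj_closed[OF M] normal_cj_closed[OF C]]
    obtain x where x: "x \<in> C" "x \<notin> M" "\<And>g. g \<in> carrier G \<Longrightarrow> comm x g \<in> M" by blast
    have xG: "x \<in> carrier G" using x(1) by (simp add: C_def centralizer_def)
    let ?A = "insert x M"
    have A: "?A \<subseteq> carrier G" using xG M.subset by simp
    have "generate G ?A \<lhd> G" by (rule normal_generate_insert[OF M xG x(3)])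
    moreover have Aab: "a \<otimes> a' = a' \<otimes> a" if "a \<in> ?A" "a' \<in> ?A" for a a'
      using that Mab centralizerD[of x M] x(1) unfolding C_def by (metis insertE)
    have "y \<otimes> z = z \<otimes> y" if "y \<in> generate G ?A" "z \<in> generate G ?A" for y z
      using generate_commute[OF A Aab that] .
    ultimately have "card (generate G ?A) \<le> card M" using Mmax by blast
    moreover have "M \<subset> generate G ?A" using x(2) by (auto intro: generate.incl)
    then have "card M < card (generate G ?A)"
      using finite_subset_carrier[OF generate_incl[OF A]] by (rule psubset_card_mono[rotated])
    ultimately show ?thesis by linarith
  qed
qed

text \<open>
  Commuting in the quotient by \<open>K = C(W)\<close> is commuting modulo \<open>K\<close>, which is the hypothesis of
  \<open>quadratic_commutator\<close>.
\<close>

lemma quadratic_family_quotient: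
  assumes W: "W \<lhd> G" "elementary_abelian p G W" and "odd p"
  defines "K \<equiv> centralizer G W"
  shows "p_group.quadratic_family (G Mod K) p ((\<lambda>x. K #> x) ` quadratic W)"
proof -
  have K: "K \<lhd> G" unfolding K_def by (rule normal_centralizer[OF W(1)])
  interpret K: normal K G by (rule K)
  interpret H: p_group "G Mod K" p by (rule p_group_quotient[OF K])
  interpret h: group_hom G "G Mod K" "\<lambda>x. K #> x" by (rule group_hom_quotient[OF K])
  note h_cj = cj_quotient[OF K] and h_comm = comm_quotient[OF K] and h_one = coset_eq_one_iff[OF K]
  have quadG: "x \<in> carrier G" if "x \<in> quadratic W" for x using that by (simp add: quadratic_def)
  show ?thesis unfolding H.quadratic_family_def
  proof (intro conjI ballI impI)
    show "(\<lambda>x. K #> x) ` quadratic W \<subseteq> carrier (G Mod K)" using quadG by auto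
  next
    fix B g assume "B \<in> (\<lambda>x. K #> x) ` quadratic W" "g \<in> carrier (G Mod K)"
    then obtain b y where "b \<in> quadratic W" "B = K #> b" "y \<in> carrier G" "g = K #> y"
      by (auto simp: carrier_FactGroup)
    then show "H.cj B g \<in> (\<lambda>x. K #> x) ` quadratic W"
      using h_cj quadG quadratic_cj[OF W(1)] by auto
  next
    fix B A assume "B \<in> (\<lambda>x. K #> x) ` quadratic W" "A \<in> carrier (G Mod K)"
      and c: "H.comm (H.comm A B) A = \<one>\<^bsub>G Mod K\<^esub>" "H.comm (H.comm A B) B = \<one>\<^bsub>G Mod K\<^esub>"
    then obtain b a where ba: "b \<in> quadratic W" "B = K #> b" "a \<in> carrier G" "A = K #> a"
      by (auto simp: carrier_FactGroup)
    then have "comm (comm a b) a \<in> K" "comm (comm a b) b \<in> K"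
      using c h_comm h_one quadG by (auto simp del: one_FactGroup)
    then have "comm a b \<in> quadratic W"
      using quadratic_commutator[OF W \<open>odd p\<close> ba(1,3)] by (simp add: K_def)
    then show "H.comm A B \<in> (\<lambda>x. K #> x) ` quadratic W" using ba h_comm quadG by auto
  next
    fix B assume "B \<in> (\<lambda>x. K #> x) ` quadratic W"
    then obtain b where b: "b \<in> quadratic W" "B = K #> b" by auto
    then have "b [^] p \<in> K" using quadratic_power_centralizes[OF W] by (simp add: K_def)
    then show "B [^]\<^bsub>G Mod K\<^esub> p = \<one>\<^bsub>G Mod K\<^esub>"
      using b quadG h_one[of "b [^] p"] h.hom_nat_pow[of b p] by simp
  qed
qed

text \<open>
  The heart of the argument, by minimality of an elementary abelian normal subgroup \<open>W\<close> that meets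
  \<open>Q\<close> nontrivially. The Baumann hypothesis handles the case in which the Thompson subgroup centralizes
  \<open>W\<close>; in the other case an element \<open>e\<close> quadratic on \<open>W\<close>, with conjugates commuting modulo \<open>C(W)\<close>, cuts
  \<open>W\<close> down to the proper subgroup \<open>C\<^sub>W(e\<^sup>G)\<close>, which still meets \<open>Q\<close> nontrivially.
\<close>

theorem ex_central_quadratic:
  assumes "odd p" and Q: "quadratic_family Q" and b0: "b0 \<in> Q" "b0 \<noteq> \<one>"
    and Baum: "Baum p G = carrier G"
  shows "\<exists>e\<in>Q. e \<noteq> \<one> \<and> (\<forall>g\<in>carrier G. e \<otimes> g = g \<otimes> e)"
proof -
  have QG: "Q \<subseteq> carrier G" using Q by (simp add: quadratic_family_def)
  let ?P = "\<lambda>W. W \<lhd> G \<and> elementary_abelian p G W \<and> (\<exists>b\<in>W \<inter> Q. b \<noteq> \<one>)"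
  have "\<exists>W. ?P W"
  proof -
    obtain e where e: "e \<in> Q" "e \<noteq> \<one>" and ecomm: "\<And>g. g \<in> carrier G \<Longrightarrow> e \<otimes> cj e g = cj e g \<otimes> e"
      using quadratic_family_ex_commuting_conjugates[OF Q b0] by blast
    have eG: "e \<in> carrier G" using e QG by blast
    let ?A = "cj e ` carrier G"
    have A: "?A \<subseteq> carrier G" using eG by auto
    have AQ: "?A \<subseteq> Q" using Q e by (auto simp: quadratic_family_def)
    have "generate G ?A \<lhd> G"
      using A eG by (intro generate_conj_normal) (auto intro!: generate.incl simp: cj_cj)
    moreover have "elementary_abelian p G (generate G ?A)"
    proof (rule elementary_abelian_generate[OF A])
      fix x y assume "x \<in> ?A" "y \<in> ?A"
      then obtain g h where gh: "g \<in> carrier G" "h \<in> carrier G" "x = cj e g" "y = cj e h" by auto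
      have "cj (e \<otimes> cj e (h \<otimes> inv g)) g = cj (cj e (h \<otimes> inv g) \<otimes> e) g"
        using ecomm[of "h \<otimes> inv g"] gh by simp
      then show "x \<otimes> y = y \<otimes> x" using gh eG by (simp add: cj_mult cj_cj m_assoc)
    qed (use AQ Q in \<open>auto simp: quadratic_family_def\<close>)
    moreover have "e \<in> generate G ?A"
      using eG by (intro generate.incl image_eqI[of _ _ \<one>]) auto
    ultimately show ?thesis using e by blast
  qed
  then obtain W where W: "W \<lhd> G" "elementary_abelian p G W" and Wex: "\<exists>b\<in>W \<inter> Q. b \<noteq> \<one>"
    and Wmin: "\<And>U. ?P U \<Longrightarrow> card W \<le> card U"
    using ex_has_least_nat[of ?P _ card] by metis
  interpret W: normal W G by (rule W(1))
  have Wab: "u \<otimes> v = v \<otimes> u" if "u \<in> W" "v \<in> W" for u v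
    using W(2) that by (simp add: elementary_abelian_iff)
  obtain b where b: "b \<in> W" "b \<in> Q" "b \<noteq> \<one>" using Wex by blast
  have bG: "b \<in> carrier G" using b by simp
  show ?thesis
  proof (cases "\<forall>E. max_elementary_abelian p G E \<longrightarrow> E \<subseteq> centralizer G W")
    case True
    then have WE: "W \<subseteq> E" if "max_elementary_abelian p G E" for E
      using that max_elementary_abelian_absorbs[OF that W(2)] centralizer_swap[OF W.subset] by blast
    let ?J = "thompson_subgroup p G"
    obtain E where "max_elementary_abelian p G E" using ex_max_elementary_abelian by blast
    then have "b \<in> ?J" using WE b(1) by (auto simp: thompson_subgroup_def intro: generate.incl)
    moreover have "?J \<subseteq> centralizer G W" unfolding thompson_subgroup_def
      using True by (intro generate_subgroup_incl subgroup_centralizer W.subset) blast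
    ultimately have "b \<in> center G ?J"
      using b(1) centralizerD[of _ W b] unfolding center_def by (simp add: subset_iff)
    moreover have "ord b = p"
    proof -
      have "b [^] p = \<one>" using Q b by (simp add: quadratic_family_def)
      then have "ord b dvd p" using bG pow_eq_id by simp
      then show ?thesis using prime_p b(3) bG ord_eq_1 by (metis prime_nat_iff)
    qed
    ultimately have "b \<in> Omega1 p G (center G ?J)" by (simp add: Omega1_def generate.incl)
    then have "\<forall>g\<in>carrier G. b \<otimes> g = g \<otimes> b"
      unfolding Baum[symmetric] Baum_def using centralizerD by metis
    then show ?thesis using b by blast
  next
    case False
    let ?K = "centralizer G W"
    have K: "?K \<lhd> G" by (rule normal_centralizer[OF W(1)])
    interpret K: normal ?K G by (rule K)
    interpret H: p_group "G Mod ?K" p by (rule p_group_quotient[OF K])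
    interpret h: group_hom G "G Mod ?K" "\<lambda>x. ?K #> x"
      by (rule group_hom_quotient[OF K])
    obtain x where x: "x \<in> quadratic W" "x \<notin> ?K"
      using False ex_quadratic_on_normal[OF W(2,1)] by blast
    have quadG: "x \<in> carrier G" if "x \<in> quadratic W" for x using that by (simp add: quadratic_def)
    have "?K #> x \<noteq> \<one>\<^bsub>G Mod ?K\<^esub>" using x coset_eq_one_iff[OF K] quadG by simp
    from H.quadratic_family_ex_commuting_conjugates[OF
        quadratic_family_quotient[OF W \<open>odd p\<close>] imageI[OF x(1)] this]
    obtain e where e: "e \<in> quadratic W" "?K #> e \<noteq> \<one>\<^bsub>G Mod ?K\<^esub>"
      and ecomm: "\<And>g. g \<in> carrier (G Mod ?K) \<Longrightarrow>
        (?K #> e) \<otimes>\<^bsub>G Mod ?K\<^esub> H.cj (?K #> e) g = H.cj (?K #> e) g \<otimes>\<^bsub>G Mod ?K\<^esub> (?K #> e)"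
      by blast
    have eG: "e \<in> carrier G" using quadG e(1) .
    have eK: "e \<notin> ?K" using e(2) coset_eq_one_iff[OF K eG] by simp
    have ecommK: "comm e (cj e g) \<in> ?K" if g: "g \<in> carrier G" for g
    proof -
      have "H.cj (?K #> e) (?K #> g) = ?K #> cj e g"
        using cj_quotient[OF K eG g] .
      moreover have "?K #> g \<in> carrier (G Mod ?K)" using g by simp
      ultimately have "H.comm (?K #> e) (?K #> cj e g) = \<one>\<^bsub>G Mod ?K\<^esub>"
        using ecomm[of "?K #> g"] eG g H.comm_eq_one_iff[of "?K #> e" "?K #> cj e g"]
        by (simp del: mult_FactGroup one_FactGroup)
      moreover have "H.comm (?K #> e) (?K #> cj e g) = ?K #> comm e (cj e g)"
        using comm_quotient[OF K eG, of "cj e g"] eG g by simp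
      ultimately show ?thesis using coset_eq_one_iff[OF K] eG g by (simp del: one_FactGroup)
    qed
    let ?F = "cj e ` carrier G"
    have F: "?F \<subseteq> carrier G" using eG by auto
    have Fquad: "f \<in> quadratic W" if "f \<in> ?F" for f
      using that quadratic_cj[OF W(1) e(1)] by auto
    have Fcomm: "comm x y \<in> ?K" if "x \<in> ?F" "y \<in> ?F" for x y
    proof -
      obtain g h where gh: "g \<in> carrier G" "h \<in> carrier G" "x = cj e g" "y = cj e h"
        using \<open>x \<in> ?F\<close> \<open>y \<in> ?F\<close> by auto
      have "comm x y = cj (comm e (cj e (h \<otimes> inv g))) g"
        using gh eG by (simp add: cj_comm cj_cj m_assoc)
      then show ?thesis using normal_cj_closed[OF K ecommK] gh by simp
    qed
    \<comment> \<open>If \<open>u\<close> fails to commute with the next conjugate \<open>f\<close>, pass to \<open>[f,u]\<close>. It commutes with \<open>f\<close> as \<open>f\<close>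
      is quadratic on \<open>W\<close>, and still commutes with the earlier conjugates since these commute with \<open>f\<close>
      modulo \<open>C(W)\<close>.\<close>
    have "\<exists>b\<in>W \<inter> Q. b \<noteq> \<one> \<and> b \<in> centralizer G F'" if "finite F'" "F' \<subseteq> ?F" for F'
      using that
    proof (induction F' rule: finite_induct)
      case empty
      have "b \<in> centralizer G {}" using bG by (intro centralizerI) auto
      then show ?case using b by blast
    next
      case (insert f F')
      then obtain u where u: "u \<in> W" "u \<in> Q" "u \<noteq> \<one>" "u \<in> centralizer G F'" by auto
      have G: "u \<in> carrier G" "f \<in> carrier G" using u insert.prems F by auto
      show ?case
      proof (cases "u \<otimes> f = f \<otimes> u")
        case True
        then have "u \<in> centralizer G (insert f F')"
          using G(1) centralizerD[OF u(4)] by (intro centralizerI) auto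
        then show ?thesis using u by blast
      next
        case False
        define c where "c = comm f u"
        have c_eq: "c = cj (inv u) f \<otimes> u" using G by (simp add: c_def comm_def cj_def)
        have "comm u f \<in> W" using normal_comm_closed[OF W(1) u(1) G(2)] .
        moreover have c_inv: "c = inv (comm u f)" using G by (simp add: c_def comm_def inv_mult_group m_assoc)
        ultimately have cW: "c \<in> W" by simp
        have cG: "c \<in> carrier G" using cW by simp
        have "c \<noteq> \<one>"
          using False comm_eq_one_iff[OF G(2,1)] by (auto simp: c_def)
        have cf: "c \<otimes> f = f \<otimes> c"
        proof -
          have "comm (comm u f) f = \<one>"
            using Fquad[of f] insert.prems u(1) by (simp add: quadratic_def)
          then have "cj (comm u f) f = comm u f" using G by (simp add: cj_eq_comm)
          then have "cj c f = c" using G by (simp add: c_inv cj_inv)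
          then show ?thesis using cj_eq_iff cG G by simp
        qed
        have "c \<otimes> u = u \<otimes> c" using Wab cW u(1) .
        then have "c \<in> Q"
          using Q u(2) G cf cG by (simp add: quadratic_family_def c_def comm_eq_one_iff)
        moreover have "c \<in> centralizer G (insert f F')"
        proof (rule centralizerI[OF cG])
          fix f' assume "f' \<in> insert f F'"
          then consider "f' = f" | "f' \<in> F'" by blast
          then show "c \<otimes> f' = f' \<otimes> c"
          proof cases
            case 2
            then have f'F: "f' \<in> ?F" and fF: "f \<in> ?F" using insert.prems by auto
            then have f'G: "f' \<in> carrier G" using F by blast
            have uf': "cj u f' = u" using centralizerD[OF u(4) 2] G(1) f'G cj_eq_iff by simp
            have "cj c f' = cj (inv u) (f \<otimes> f') \<otimes> u"
              using G f'G uf' by (simp add: c_eq cj_mult cj_cj)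
            also have "cj (inv u) (f \<otimes> f') = cj (cj (inv u) f) f'" using G f'G by (simp add: cj_cj)
            also have "\<dots> = cj (cj (inv u) f') f"
              using cj_swap_mod_centralizer[OF W(1) _ G(2) f'G Fcomm[OF fF f'F]] u(1) by simp
            also have "\<dots> = cj (inv u) f" using uf' G f'G by (simp add: cj_inv)
            finally have "cj c f' = c" by (simp add: c_eq)
            then show ?thesis using cj_eq_iff cG f'G by simp
          qed (simp add: cf)
        qed
        ultimately show ?thesis using cW \<open>c \<noteq> \<one>\<close> by blast
      qed
    qed
    from this[of ?F] have Uex: "\<exists>b\<in>(W \<inter> centralizer G ?F) \<inter> Q. b \<noteq> \<one>" by auto
    let ?U = "W \<inter> centralizer G ?F"
    have subU: "subgroup ?U G" by (intro subgroups_Inter_pair W.subgroup_axioms subgroup_centralizer F)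
    have "?U \<lhd> G"
    proof (rule normalI_cj[OF subU])
      fix u g assume u: "u \<in> ?U" and g: "g \<in> carrier G"
      have uG: "u \<in> carrier G" using u by simp
      have "cj u g \<otimes> f = f \<otimes> cj u g" if f: "f \<in> ?F" for f
      proof -
        have fG: "f \<in> carrier G" using f F by blast
        obtain h where h: "h \<in> carrier G" "f = cj e h" using f by auto
        have "cj f (inv g) \<in> ?F" using h g eG by (auto simp: cj_cj)
        then have "u \<otimes> cj f (inv g) = cj f (inv g) \<otimes> u" using u centralizerD by blast
        then have "cj (u \<otimes> cj f (inv g)) g = cj (cj f (inv g) \<otimes> u) g" by simp
        then show ?thesis using uG g fG by (simp add: cj_mult)
      qed
      then have "cj u g \<in> centralizer G ?F" using uG g by (intro centralizerI) auto
      moreover have "cj u g \<in> W" using u normal_cj_closed[OF W(1) _ g] by blast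
      ultimately show "cj u g \<in> ?U" by blast
    qed
    moreover have "elementary_abelian p G ?U" using elementary_abelian_subset[OF W(2) subU] by blast
    ultimately have "card W \<le> card ?U" using Wmin Uex by blast
    then have "?U = W" using finite_subset_carrier[OF W.subset] by (intro card_seteq) auto
    then have "W \<subseteq> centralizer G ?F" by blast
    then have "?F \<subseteq> ?K" by (rule centralizer_swap[OF F])
    moreover have "e \<in> ?F" using eG by (intro image_eqI[of _ _ \<one>]) auto
    ultimately show ?thesis using eK by blast
  qed
qed

end

section \<open>Oliver series\<close>

context group begin

lemma commutator_subgroup_eq: "commutator_subgroup G A B = generate G {comm x y | x y. x \<in> A \<and> y \<in> B}"
  by (simp add: commutator_subgroup_def comm_def)

lemma iter_commutator_mono:
  "A \<subseteq> A' \<Longrightarrow> iter_commutator G A B n \<subseteq> iter_commutator G A' B n"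
proof (induction n)
  case (Suc n)
  then have "{comm x y | x y. x \<in> iter_commutator G A B n \<and> y \<in> B} \<subseteq>
      {comm x y | x y. x \<in> iter_commutator G A' B n \<and> y \<in> B}" by blast
  then show ?case by (simp add: commutator_subgroup_eq mono_generate)
qed simp

lemma generate_triv: "A \<subseteq> {\<one>} \<Longrightarrow> generate G A = {\<one>}"
  using generate_subgroup_incl[OF _ triv_subgroup, of A] generate.one[of G A] by blast

lemma iter_commutator_triv_mono:
  assumes B: "B \<subseteq> carrier G" and "iter_commutator G A B n = {\<one>}" and "n \<le> m"
  shows "iter_commutator G A B m = {\<one>}"
  using \<open>n \<le> m\<close>
proof (induction m rule: dec_induct)
  case (step m)
  have "comm \<one> y = \<one>" if "y \<in> B" for y using that B by (auto simp: comm_def)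
  then have "{comm x y | x y. x \<in> {\<one>} \<and> y \<in> B} \<subseteq> {\<one>}" by auto
  then show ?case using step.IH by (simp add: commutator_subgroup_eq generate_triv)
qed (rule assms(2))

text \<open>
  Elements of \<open>K\<close> act trivially on \<open>C(K)\<close>, and iterated commutators that start in the normal subgroup
  \<open>C(K)\<close> stay there; so a factor from \<open>K\<close> in the second argument has no effect.
\<close>

lemma iter_commutator_set_mult:
  assumes K: "K \<lhd> G" and R: "R \<subseteq> carrier G" and A: "A \<subseteq> centralizer G K"
  shows "iter_commutator G A (K <#> R) n \<subseteq> iter_commutator G A R n"
    and "iter_commutator G A R n \<subseteq> centralizer G K"
proof -
  have KG: "K \<subseteq> carrier G" using K by (simp add: normal_imp_subgroup subgroup.subset)
  have C: "centralizer G K \<lhd> G" by (rule normal_centralizer[OF K])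
  have 2: "iter_commutator G A R n \<subseteq> centralizer G K" for n
  proof (induction n)
    case (Suc n)
    show ?case unfolding iter_commutator.simps commutator_subgroup_eq
      by (rule generate_subgroup_incl[OF _ normal_imp_subgroup[OF C]])
        (use Suc R normal_comm_closed[OF C] in blast)
  qed (use A in simp)
  then show "iter_commutator G A R n \<subseteq> centralizer G K" .
  have "comm u (y \<otimes> r) = comm u r"
    if u: "u \<in> centralizer G K" and y: "y \<in> K" and r: "r \<in> carrier G" for u y r
  proof -
    have G: "u \<in> carrier G" "y \<in> carrier G" using u y KG by (auto simp: centralizer_def)
    have "cj u y = u" using centralizerD[OF u y] cj_eq_iff G by simp
    then have "cj u (y \<otimes> r) = cj u r" using G r by (simp flip: cj_cj)
    then show ?thesis using G r by (simp add: comm_eq_cj)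
  qed
  note absorb = this
  show "iter_commutator G A (K <#> R) n \<subseteq> iter_commutator G A R n"
  proof (induction n)
    case (Suc n)
    have "{comm x z | x z. x \<in> iter_commutator G A (K <#> R) n \<and> z \<in> K <#> R}
      \<subseteq> {comm x r | x r. x \<in> iter_commutator G A R n \<and> r \<in> R}"
    proof safe
      fix x z assume "x \<in> iter_commutator G A (K <#> R) n" "z \<in> K <#> R"
      then obtain y r where x: "x \<in> iter_commutator G A R n" and yr: "y \<in> K" "r \<in> R" "z = y \<otimes> r"
        using Suc unfolding set_mult_def by blast
      then have "comm x z = comm x r" using 2 R absorb by blast
      then show "\<exists>x' r. comm x z = comm x' r \<and> x' \<in> iter_commutator G A R n \<and> r \<in> R"
        using x yr by blast
    qed
    then show ?case by (simp add: commutator_subgroup_eq mono_generate)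
  qed simp
qed

lemma has_oliver_series_normal: "has_oliver_series p k G K \<Longrightarrow> K \<lhd> G"
  unfolding has_oliver_series_def by blast

lemma has_oliver_series_triv: "has_oliver_series p k G {\<one>}"
  unfolding has_oliver_series_def
  by (rule exI[of _ "\<lambda>_. {\<one>}"], rule exI[of _ 0]) (auto intro: normalI_cj triv_subgroup)

lemma has_oliver_series_extend:
  assumes K: "has_oliver_series p k G K" and Q: "Q \<lhd> G" "K \<subset> Q"
    and triv: "iter_commutator G (Omega1 p G (centralizer G K)) Q (k - 1) = {\<one>}"
  shows "has_oliver_series p k G Q"
proof -
  obtain F n where F: "F 0 = {\<one>}" "F n = K" "\<forall>i<n. F i \<subset> F (Suc i)" "\<forall>i\<le>n. F i \<lhd> G"
    "\<forall>i\<in>{1..n}. iter_commutator G (Omega1 p G (centralizer G (F (i - 1)))) (F i) (k - 1) = {\<one>}"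
    using K unfolding has_oliver_series_def by (elim exE conjE) (rule that)
  let ?F = "F(Suc n := Q)"
  have "iter_commutator G (Omega1 p G (centralizer G (?F (i - 1)))) (?F i) (k - 1) = {\<one>}"
    if "i \<in> {1..Suc n}" for i
    using that F(2,5) triv by (cases "i = Suc n") auto
  moreover have "?F i \<subset> ?F (Suc i)" if "i < Suc n" for i
    using that F(2,3) Q by (cases "i = n") auto
  moreover have "?F i \<lhd> G" if "i \<le> Suc n" for i
    using that F(4) Q by (cases "i = Suc n") auto
  ultimately show ?thesis unfolding has_oliver_series_def
    using F(1) by (intro exI[of _ ?F] exI[of _ "Suc n"]) auto
qed

lemma Omega1_mono: "H \<subseteq> H' \<Longrightarrow> Omega1 p G H \<subseteq> Omega1 p G H'"
  unfolding Omega1_def by (rule mono_generate) blast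

lemma Omega1_subset: "subgroup H G \<Longrightarrow> Omega1 p G H \<subseteq> H"
  unfolding Omega1_def by (rule generate_subgroup_incl) blast+

lemma ord_cj:
  assumes "x \<in> carrier G" "g \<in> carrier G"
  shows "ord (cj x g) = ord x"
proof -
  have "cj x g [^] n = cj (x [^] n) g" for n :: nat
    by (induction n) (use assms in \<open>simp_all add: cj_mult\<close>)
  then have "cj x g [^] n = \<one> \<longleftrightarrow> x [^] n = \<one>" for n :: nat
    using assms cj_inject[of "x [^] n" \<one> g] by simp
  then show ?thesis using assms pow_eq_id[of x] by (subst ord_unique) auto
qed

lemma Omega1_normal:
  assumes "H \<lhd> G"
  shows "Omega1 p G H \<lhd> G"
  unfolding Omega1_def
proof (rule generate_conj_normal)
  show "{x \<in> H. ord x = p} \<subseteq> carrier G"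
    using assms by (auto dest: normal_imp_subgroup subgroup.mem_carrier)
  fix a x assume "a \<in> {x \<in> H. ord x = p}" "x \<in> carrier G"
  then show "cj a x \<in> generate G {x \<in> H. ord x = p}"
    using assms ord_cj[of a x] normal_cj_closed[OF assms]
    by (intro generate.incl) (auto dest: normal_imp_subgroup subgroup.mem_carrier)
qed

text \<open>
  Let \<open>K\<close> be a subgroup of largest order among those with a series, and let \<open>R\<close> be the series of
  another such subgroup. By induction every \<open>R i\<close> lies in \<open>K\<close>: if \<open>R i \<le> K\<close>, then
  \<open>C(K) \<le> C(R i)\<close>, so the commutator condition for \<open>R (Suc i)\<close> gives that for \<open>K R (Suc i)\<close> over \<open>K\<close>,
  and \<open>K R (Suc i) = K\<close> by maximality.
\<close>

lemma oliver_subgroup_greatest: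
  assumes "finite (carrier G)"
  shows "has_oliver_series p k G (oliver_subgroup p k G)"
    and "has_oliver_series p k G L \<Longrightarrow> L \<subseteq> oliver_subgroup p k G"
proof -
  have le: "card K \<le> card (carrier G)" if "has_oliver_series p k G K" for K
    using has_oliver_series_normal[OF that] assms
    by (intro card_mono) (auto dest: normal_imp_subgroup subgroup.subset)
  obtain K where K: "has_oliver_series p k G K"
    and Kmax: "\<And>L. has_oliver_series p k G L \<Longrightarrow> card L \<le> card K"
    using ex_has_greatest_nat[of "has_oliver_series p k G", OF has_oliver_series_triv,
        of card "Suc (card (carrier G))"] le by (auto simp: less_Suc_eq_le)
  have Kn: "K \<lhd> G" using K by (rule has_oliver_series_normal)
  have KG: "K \<subseteq> carrier G" using Kn by (simp add: normal_imp_subgroup subgroup.subset)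
  have greatest: "L \<subseteq> K" if L: "has_oliver_series p k G L" for L
  proof -
    obtain R n where R: "R 0 = {\<one>}" "R n = L" "\<forall>i<n. R i \<subset> R (Suc i)" "\<forall>i\<le>n. R i \<lhd> G"
      "\<forall>i\<in>{1..n}. iter_commutator G (Omega1 p G (centralizer G (R (i - 1)))) (R i) (k - 1) = {\<one>}"
      using L unfolding has_oliver_series_def by (elim exE conjE) (rule that)
    have "i \<le> n \<Longrightarrow> R i \<subseteq> K" for i
    proof (induction i)
      case 0
      then show ?case using R(1) Kn by (simp add: normal_imp_subgroup subgroup.one_closed)
    next
      case (Suc i)
      then have RK: "R i \<subseteq> K" by simp
      let ?Q = "K <#> R (Suc i)" and ?A = "Omega1 p G (centralizer G K)"
      have Rn: "R (Suc i) \<lhd> G" using R(4) Suc.prems by blast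
      have RG: "R (Suc i) \<subseteq> carrier G" using Rn by (simp add: normal_imp_subgroup subgroup.subset)
      have Q: "?Q \<lhd> G" by (rule normal_set_mult[OF Kn Rn])
      have QG: "?Q \<subseteq> carrier G" using Q by (simp add: normal_imp_subgroup subgroup.subset)
      have KQ: "K \<subseteq> ?Q"
      proof
        fix x assume x: "x \<in> K"
        have "x \<otimes> \<one> \<in> ?Q" unfolding set_mult_def
          using x subgroup.one_closed[OF normal_imp_subgroup[OF Rn]] by blast
        then show "x \<in> ?Q" using x KG by auto
      qed
      have RQ: "R (Suc i) \<subseteq> ?Q"
      proof
        fix x assume x: "x \<in> R (Suc i)"
        have "\<one> \<otimes> x \<in> ?Q" unfolding set_mult_def
          using x subgroup.one_closed[OF normal_imp_subgroup[OF Kn]] by blast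
        then show "x \<in> ?Q" using x RG by auto
      qed
      have "centralizer G K \<subseteq> centralizer G (R i)" using RK by (auto simp: centralizer_def)
      then have "iter_commutator G ?A (R (Suc i)) (k - 1)
          \<subseteq> iter_commutator G (Omega1 p G (centralizer G (R i))) (R (Suc i)) (k - 1)"
        by (intro iter_commutator_mono Omega1_mono)
      also have "\<dots> = {\<one>}" using bspec[OF R(5), of "Suc i"] Suc.prems by simp
      finally have "iter_commutator G ?A ?Q (k - 1) \<subseteq> {\<one>}"
        using iter_commutator_set_mult(1)[OF Kn RG Omega1_subset[OF subgroup_centralizer[OF KG]]]
        by blast
      moreover have "\<one> \<in> iter_commutator G ?A ?Q (k - 1)"
        by (cases "k - 1") (auto simp: Omega1_def commutator_subgroup_def generate.one)
      ultimately have triv: "iter_commutator G ?A ?Q (k - 1) = {\<one>}" by blast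
      have "K = ?Q"
      proof (rule ccontr)
        assume "K \<noteq> ?Q"
        then have "K \<subset> ?Q" using KQ by blast
        then have "card ?Q \<le> card K" using Kmax has_oliver_series_extend[OF K Q _ triv] by blast
        moreover have "card K < card ?Q"
          using \<open>K \<subset> ?Q\<close> finite_subset[OF QG assms] by (simp add: psubset_card_mono)
        ultimately show False by simp
      qed
      then show ?case using RQ by simp
    qed
    then show ?thesis using R(2) by blast
  qed
  have "oliver_subgroup p k G = K"
    unfolding oliver_subgroup_def using K greatest by (intro Greatest_equality)
  then show "has_oliver_series p k G (oliver_subgroup p k G)"
    and "has_oliver_series p k G L \<Longrightarrow> L \<subseteq> oliver_subgroup p k G"
    using K greatest by simp_all
qed

text \<open>
  Suppose \<open>x \<notin> Y\<close> and let \<open>Q\<close> be generated by \<open>Y\<close> and \<open>x\<close>; it is normal as \<open>x\<close> is central modulo \<open>Y\<close>.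
  For \<open>V = \<Omega>\<^sub>1(C(Y))\<close>, the commutators \<open>[v,x]\<close> are centralized by \<open>x\<close>, because \<open>x\<close> is quadratic on \<open>V\<close>,
  and by \<open>Y\<close>, because \<open>V\<close> is a normal subgroup inside \<open>C(Y)\<close>. So \<open>[V,Q;2] = 1\<close>, and since
  \<open>k - 1 \<ge> 2\<close> the group \<open>Q\<close> prolongs the series of \<open>Y\<close>.
\<close>

lemma oliver_subgroup_absorbs:
  fixes p k :: nat
  assumes fin: "finite (carrier G)" and "3 \<le> k"
  defines "Y \<equiv> oliver_subgroup p k G"
  assumes x: "x \<in> carrier G" and central: "\<And>g. g \<in> carrier G \<Longrightarrow> comm x g \<in> Y"
    and quad: "x \<in> quadratic (Omega1 p G (centralizer G Y))"
  shows "x \<in> Y"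
proof (rule ccontr)
  assume "x \<notin> Y"
  have series: "has_oliver_series p k G Y" unfolding Y_def by (rule oliver_subgroup_greatest[OF fin])
  have Y: "Y \<lhd> G" using series by (rule has_oliver_series_normal)
  have YG: "Y \<subseteq> carrier G" using Y by (simp add: normal_imp_subgroup subgroup.subset)
  let ?A = "insert x Y"
  let ?Q = "generate G ?A" and ?V = "Omega1 p G (centralizer G Y)"
  have A: "?A \<subseteq> carrier G" using x YG by simp
  have QG: "?Q \<subseteq> carrier G" using A by (rule generate_incl)
  have Q: "?Q \<lhd> G" by (rule normal_generate_insert[OF Y x central])
  have V: "?V \<lhd> G" by (intro Omega1_normal normal_centralizer Y)
  have VC: "?V \<subseteq> centralizer G Y" by (intro Omega1_subset subgroup_centralizer YG)
  have VG: "v \<in> carrier G" if "v \<in> ?V" for v using that VC by (auto simp: centralizer_def)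
  have subC: "subgroup (centralizer G ?Q) G" by (rule subgroup_centralizer[OF QG])
  have gen: "comm v a \<in> centralizer G ?Q" if v: "v \<in> ?V" and a: "a \<in> ?A" for v a
  proof -
    have vG: "v \<in> carrier G" using VG[OF v] .
    have aG: "a \<in> carrier G" using a A by blast
    have cV: "comm v a \<in> centralizer G Y" using normal_comm_closed[OF V v aG] VC by blast
    have "comm v a \<in> centralizer G ?A"
    proof (cases "a = x")
      case True
      have "comm (comm v x) x = \<one>" using quad v by (simp add: quadratic_def)
      then have "comm v x \<otimes> x = x \<otimes> comm v x" using vG x by (simp add: comm_eq_one_iff)
      then show ?thesis
        using True cV centralizerD[OF cV] vG x by (intro centralizerI) auto
    next
      case False
      then have "v \<otimes> a = a \<otimes> v" using a v VC centralizerD[of v Y a] by blast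
      then have "comm v a = \<one>" using vG aG by (simp add: comm_eq_one_iff)
      then show ?thesis using subgroup.one_closed[OF subgroup_centralizer[OF A]] by simp
    qed
    then show ?thesis using centralizer_generate[OF A] by blast
  qed
  have comm: "comm v q \<in> centralizer G ?Q" if v: "v \<in> ?V" and q: "q \<in> ?Q" for v q
    using q
  proof (induction q rule: generate.induct)
    case one
    show ?case using VG[OF v] subgroup.one_closed[OF subC] by (simp add: comm_def)
  next
    case (incl h)
    then show ?case by (rule gen[OF v])
  next
    case (inv h)
    then have hG: "h \<in> carrier G" and h: "inv h \<in> ?Q" using A by (auto intro: generate.inv)
    have c: "comm v h \<in> centralizer G ?Q" using gen[OF v inv] .
    have "cj (comm v h) (inv h) = comm v h"
      using centralizerD[OF c h] VG[OF v] hG by (simp add: cj_eq_iff)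
    then show ?case using c VG[OF v] hG subgroup.m_inv_closed[OF subC] by (simp add: comm_inv_right)
  next
    case (eng q r)
    then have G: "q \<in> carrier G" "r \<in> carrier G" using QG by auto
    have "cj (comm v q) r = comm v q"
      using centralizerD[OF eng.IH(1) eng.hyps(2)] VG[OF v] G by (simp add: cj_eq_iff)
    then show ?case
      using eng.IH VG[OF v] G subgroup.m_closed[OF subC] by (simp add: comm_mult_right)
  qed
  have "commutator_subgroup G ?V ?Q \<subseteq> centralizer G ?Q"
    unfolding commutator_subgroup_eq using comm by (intro generate_subgroup_incl subC) blast
  then have "{comm u q | u q. u \<in> commutator_subgroup G ?V ?Q \<and> q \<in> ?Q} \<subseteq> {\<one>}"
  proof safe
    fix u q assume "u \<in> commutator_subgroup G ?V ?Q" "q \<in> ?Q"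
    then have "u \<in> centralizer G ?Q" "q \<in> carrier G" "q \<in> ?Q"
      using \<open>commutator_subgroup G ?V ?Q \<subseteq> _\<close> QG by auto
    then show "comm u q = \<one>"
      using centralizerD[of u ?Q q] by (simp add: comm_eq_one_iff centralizer_def)
  qed
  then have "iter_commutator G ?V ?Q 2 = {\<one>}"
    by (simp add: numeral_2_eq_2 commutator_subgroup_eq[of "commutator_subgroup G ?V ?Q"] generate_triv)
  then have "iter_commutator G ?V ?Q (k - 1) = {\<one>}"
    using iter_commutator_triv_mono[OF QG] \<open>3 \<le> k\<close> by simp
  moreover have "Y \<subset> ?Q" using \<open>x \<notin> Y\<close> by (auto intro: generate.incl)
  ultimately have "?Q \<subseteq> Y"
    unfolding Y_def using oliver_subgroup_greatest(2)[OF fin] has_oliver_series_extend[OF series Q]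
    unfolding Y_def by blast
  then show False using \<open>Y \<subset> ?Q\<close> by blast
qed

end

context p_group begin

text \<open>
  Otherwise some \<open>x \<in> C(Y) - Y\<close> is central modulo \<open>Y \<inter> C(Y)\<close>. Then \<open>[v,x] \<in> Y\<close> commutes with \<open>x\<close> for
  every \<open>v\<close>, so \<open>x\<close> is quadratic on the whole group and is absorbed by \<open>Y\<close>.
\<close>

lemma centralizer_oliver_subgroup_le:
  assumes "3 \<le> k"
  shows "centralizer G (oliver_subgroup p k G) \<subseteq> oliver_subgroup p k G"
proof (rule ccontr)
  let ?Y = "oliver_subgroup p k G"
  let ?C = "centralizer G ?Y" and ?D = "?Y \<inter> centralizer G ?Y"
  assume "\<not> ?C \<subseteq> ?Y"
  then have "?D \<subset> ?C" by blast
  have Y: "?Y \<lhd> G"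
    using oliver_subgroup_greatest(1)[OF finite_carrier] by (rule has_oliver_series_normal)
  have C: "?C \<lhd> G" by (rule normal_centralizer[OF Y])
  have D: "subgroup ?D G" by (intro subgroups_Inter_pair normal_imp_subgroup Y C)
  have "cj a e \<in> ?D" if "a \<in> ?D" "e \<in> carrier G" for a e
    using that normal_cj_closed[OF Y] normal_cj_closed[OF C] by blast
  from ex_fixed_coset[OF D normal_imp_subgroup[OF C] subgroup_self \<open>?D \<subset> ?C\<close> this normal_cj_closed[OF C]]
  obtain x where x: "x \<in> ?C" "x \<notin> ?Y" "\<And>g. g \<in> carrier G \<Longrightarrow> comm x g \<in> ?Y" by blast
  have xG: "x \<in> carrier G" using x(1) by (simp add: centralizer_def)
  have "comm (comm v x) x = \<one>" if v: "v \<in> carrier G" for v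
  proof -
    have "comm v x = inv (comm x v)" using v xG by (simp add: comm_def inv_mult_group m_assoc)
    then have "comm v x \<in> ?Y"
      using x(3)[OF v] subgroup.m_inv_closed[OF normal_imp_subgroup[OF Y]] by simp
    then show ?thesis using centralizerD[OF x(1)] v xG by (simp add: comm_eq_one_iff)
  qed
  moreover have "Omega1 p G ?C \<subseteq> carrier G"
    using Omega1_normal[OF C] by (simp add: normal_imp_subgroup subgroup.subset)
  ultimately have "x \<in> quadratic (Omega1 p G ?C)" using xG by (auto simp: quadratic_def)
  then show False using oliver_subgroup_absorbs[OF finite_carrier assms xG x(3)] x(2) by blast
qed

lemma elementary_abelian_Omega1_centralizer:
  assumes "H \<subseteq> carrier G" "centralizer G H \<subseteq> H"
  shows "elementary_abelian p G (Omega1 p G (centralizer G H))"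
  unfolding Omega1_def
proof (rule elementary_abelian_generate)
  show "{x \<in> centralizer G H. ord x = p} \<subseteq> carrier G" by (auto simp: centralizer_def)
  show "a \<otimes> b = b \<otimes> a" if "a \<in> {x \<in> centralizer G H. ord x = p}" "b \<in> {x \<in> centralizer G H. ord x = p}" for a b
    using that assms(2) centralizerD[of a H b] by blast
  show "a [^] p = \<one>" if "a \<in> {x \<in> centralizer G H. ord x = p}" for a
    using that pow_ord_eq_1[of a] by (auto simp: centralizer_def)
qed

text \<open>
  The quotient by the Oliver subgroup \<open>Y\<close> acts faithfully on \<open>V = \<Omega>\<^sub>1(C(Y))\<close>: an element of
  \<open>C(V) - Y\<close> that is central modulo \<open>Y\<close> is trivially quadratic on \<open>V\<close>, hence absorbed by \<open>Y\<close>.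
\<close>

lemma centralizer_Omega1_centralizer_oliver_subgroup:
  assumes "3 \<le> k"
  shows "centralizer G (Omega1 p G (centralizer G (oliver_subgroup p k G))) = oliver_subgroup p k G"
proof (rule ccontr)
  let ?Y = "oliver_subgroup p k G"
  let ?V = "Omega1 p G (centralizer G ?Y)"
  assume ne: "centralizer G ?V \<noteq> ?Y"
  have Y: "?Y \<lhd> G"
    using oliver_subgroup_greatest(1)[OF finite_carrier] by (rule has_oliver_series_normal)
  have YG: "?Y \<subseteq> carrier G" using Y by (simp add: normal_imp_subgroup subgroup.subset)
  have V: "?V \<lhd> G" by (intro Omega1_normal normal_centralizer Y)
  have C: "centralizer G ?V \<lhd> G" by (rule normal_centralizer[OF V])
  have "?Y \<subseteq> centralizer G ?V"
    by (rule centralizer_swap[OF YG Omega1_subset[OF subgroup_centralizer[OF YG]]])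
  then have "?Y \<subset> centralizer G ?V" using ne by blast
  from ex_fixed_coset[OF normal_imp_subgroup[OF Y] normal_imp_subgroup[OF C] subgroup_self this
      normal_cj_closed[OF Y] normal_cj_closed[OF C]]
  obtain x where x: "x \<in> centralizer G ?V" "x \<notin> ?Y" "\<And>g. g \<in> carrier G \<Longrightarrow> comm x g \<in> ?Y" by blast
  have xG: "x \<in> carrier G" using x(1) by (simp add: centralizer_def)
  have "comm (comm v x) x = \<one>" if v: "v \<in> ?V" for v
  proof -
    have vG: "v \<in> carrier G" using v V by (meson normal_imp_subgroup subgroup.mem_carrier)
    have "comm v x = \<one>" using centralizerD[OF x(1) v] vG xG by (simp add: comm_eq_one_iff)
    then show ?thesis using xG by (simp add: comm_def)
  qed
  then have "x \<in> quadratic ?V" using xG by (simp add: quadratic_def)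
  then show False using oliver_subgroup_absorbs[OF finite_carrier assms xG x(3)] x(2) by blast
qed

text \<open>
  If some elementary abelian subgroup of maximal order is not contained in \<open>Y = C(V)\<close>, the quotient by \<open>Y\<close> has a
  nontrivial quadratic family, hence a nontrivial central member of it by the Baumann hypothesis. A preimage
  of that member is absorbed by \<open>Y\<close>, a contradiction.
\<close>

theorem thompson_le_oliver_subgroup:
  assumes "odd p" "3 \<le> k"
  defines "Y \<equiv> oliver_subgroup p k G"
  assumes Baum: "Baum p (G Mod Y) = carrier (G Mod Y)"
  shows "thompson_subgroup p G \<subseteq> Y"
proof -
  let ?V = "Omega1 p G (centralizer G Y)"
  have Y: "Y \<lhd> G" unfolding Y_def
    using oliver_subgroup_greatest(1)[OF finite_carrier] by (rule has_oliver_series_normal)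
  have YG: "Y \<subseteq> carrier G" using Y by (simp add: normal_imp_subgroup subgroup.subset)
  have V: "?V \<lhd> G" by (intro Omega1_normal normal_centralizer Y)
  have Vab: "elementary_abelian p G ?V"
    using elementary_abelian_Omega1_centralizer[OF YG] centralizer_oliver_subgroup_le[OF \<open>3 \<le> k\<close>]
    by (simp add: Y_def)
  have CV: "centralizer G ?V = Y"
    unfolding Y_def by (rule centralizer_Omega1_centralizer_oliver_subgroup[OF \<open>3 \<le> k\<close>])
  have "E \<subseteq> Y" if E: "max_elementary_abelian p G E" for E
  proof (rule ccontr)
    assume "\<not> E \<subseteq> Y"
    then obtain b where b: "b \<in> quadratic ?V" "b \<notin> Y"
      using ex_quadratic_on_normal[OF Vab V E] CV by auto
    interpret Y: normal Y G by (rule Y)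
    interpret H: p_group "G Mod Y" p by (rule p_group_quotient[OF Y])
    have quadG: "x \<in> carrier G" if "x \<in> quadratic ?V" for x using that by (simp add: quadratic_def)
    have fam: "H.quadratic_family ((\<lambda>x. Y #> x) ` quadratic ?V)"
      using quadratic_family_quotient[OF V Vab \<open>odd p\<close>] unfolding CV .
    have "Y #> b \<noteq> \<one>\<^bsub>G Mod Y\<^esub>" using b coset_eq_one_iff[OF Y] quadG by simp
    from H.ex_central_quadratic[OF \<open>odd p\<close> fam imageI[OF b(1)] this Baum]
    obtain e where e: "e \<in> quadratic ?V" "Y #> e \<noteq> \<one>\<^bsub>G Mod Y\<^esub>"
      and ecomm: "\<And>g. g \<in> carrier (G Mod Y) \<Longrightarrow>
        (Y #> e) \<otimes>\<^bsub>G Mod Y\<^esub> g = g \<otimes>\<^bsub>G Mod Y\<^esub> (Y #> e)" by blast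
    have eG: "e \<in> carrier G" using quadG e(1) .
    have "comm e g \<in> Y" if g: "g \<in> carrier G" for g
    proof -
      have cosets: "Y #> e \<in> carrier (G Mod Y)" "Y #> g \<in> carrier (G Mod Y)"
        using eG g by (auto simp: carrier_FactGroup)
      have "H.comm (Y #> e) (Y #> g) = \<one>\<^bsub>G Mod Y\<^esub>"
        using ecomm[OF cosets(2)] H.comm_eq_one_iff[OF cosets] by blast
      then show ?thesis
        using comm_quotient[OF Y eG g] coset_eq_one_iff[OF Y] eG g by (metis comm_closed)
    qed
    then have "e \<in> Y"
      using oliver_subgroup_absorbs[OF finite_carrier \<open>3 \<le> k\<close> eG] e(1) unfolding Y_def by blast
    then show False using e(2) coset_eq_one_iff[OF Y eG] by simp
  qed
  then show ?thesis
    unfolding thompson_subgroup_def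
    by (intro generate_subgroup_incl normal_imp_subgroup[OF Y]) blast
qed

end

theorem theorem2:
  fixes p :: nat and S :: "('a, 'b) monoid_scheme"
  assumes "Factorial_Ring.prime p" and "p \<ge> 5" and "finite_p_group p S"
  shows "(\<forall>k. 3 \<le> k \<and> k \<le> p \<longrightarrow>
            Baum p (S Mod oliver_subgroup p k S) = carrier (S Mod oliver_subgroup p k S) \<longrightarrow>
            thompson_subgroup p S \<subseteq> oliver_subgroup p k S) \<and>
         (Baum p (S Mod oliver_subgroup p p S) = carrier (S Mod oliver_subgroup p p S) \<longrightarrow>
            oliver_conjecture p S)"
proof -
  interpret p_group S p
    using assms by (simp add: p_group_def p_group_axioms_def finite_p_group_def)
  have "odd p" using assms(1,2) prime_odd_nat by simp
  then show ?thesis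
    using thompson_le_oliver_subgroup \<open>p \<ge> 5\<close> by (auto simp: oliver_conjecture_def)
qed

end
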